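(* Let $w$ be a 321-avoiding permutation, with associated sequences $\bm{p}=(p_1>\cdots>p_t>0)$ and $\bm{q}=(q_1>\cdots>q_t>0)$ satisfying $q_i\ge p_i-1$ for all $i$, and let $\lambda/\mu$ be the corresponding skew Young diagram, $\lambda_i=q_i-t+i$, $\mu_j=p_j-(t+1-j)$. The double Grothendieck polynomial for $w$ has the determinantal expression $$\mathfrak{G}_w(x,y)=\Delta_{\lambda/\mu}(c;\beta)=\det\left(\sum_{k\ge0}\binom{\lambda_i-\mu_j+k-1}{k}\beta^kc_{\lambda_i-\mu_j+j-i+k}(i,j)\right)_{1\le i,j\le t},$$ where $c_k(i,j)$ is the coefficient of $u^k$ in the expansion (in powers of $x$ and $y$) of $$c(i,j)=\prod_{a=1}^{q_i}\prod_{b=1}^{p_j}\frac{(1+\beta y_a-uy_a)(1+\beta x_b)}{(1+\beta y_a)(1+\beta x_b-ux_b)},$$ meaning the product of $\prod_{a=1}^{q_i}\frac{1+\beta y_a-uy_a}{1+\beta y_a}$ and $\prod_{b=1}^{p_j}\frac{1+\beta x_b}{1+\beta x_b-ux_b}$.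
   Context: A permutation $w$ is 321-avoiding if there are no $a<b<c$ with $w(a)>w(b)>w(c)$. The sequences $\bm{p},\bm{q}$ are associated to $w$ if $w$ is the permutation obtained by setting $w(p_i)=q_i+1$ for $1\le i\le t$ and filling in the remaining entries with the unused positive integers in increasing order. (Every 321-avoiding permutation arises this way.) Conventions: $c_m(i,j)=0$ for $m<0$; $\binom{s}{k}=\frac{s(s-1)\cdots(s-k+1)}{k!}$ for any integer $s$. Identities are in the ring of formal power series in the $x$ and $y$ variables over $\mathbb{Z}[\beta]$. Double Grothendieck polynomials $\mathfrak{G}_w(x,y)$ (with parameter $\beta$) represent classes of structure sheaves of Schubert varieties (degeneracy loci) and are defined inductively: for the longest element $w_0\in S_n$, $\mathfrak{G}_{w_0}(x,y)=\prod_{i+j\le n}\frac{x_i-y_j}{1+\beta y_j}$, and if $w(i)>w(i+1)$, then $\mathfrak{G}_{ws_i}=\pi_i\mathfrak{G}_w$, where $\pi_i f=\frac{(1+\beta x_{i+1})f-(1+\beta x_i)s_if}{x_i-x_{i+1}}$ and $s_i$ exchanges $x_i$ and $x_{i+1}$. *)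

theory Defs
  imports
    "HOL-Library.Poly_Mapping"
    "HOL-Computational_Algebra.Polynomial"
    "HOL-Combinatorics.Permutations"
    "HOL-Combinatorics.Transposition"
    "Jordan_Normal_Form.Determinant"
begin

section \<open>Multivariate formal power series\<close>

text \<open>
  Power series in an arbitrary set of commuting variables: one coefficient for every monomial, a
  monomial being a finitely supported exponent function.
\<close>

typedef (overloaded) ('v, 'a) mfps = "UNIV :: (('v \<Rightarrow>\<^sub>0 nat) \<Rightarrow> 'a) set"
  morphisms mcoeff Abs_mfps ..

lemma mcoeff_Abs_mfps [simp]: "mcoeff (Abs_mfps f) = f"
  by (simp add: Abs_mfps_inverse)

lemma mfps_eqI: "(\<And>m. mcoeff f m = mcoeff g m) \<Longrightarrow> f = g"
  by (metis ext mcoeff_inject)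

definition splittings :: "('v \<Rightarrow>\<^sub>0 nat) \<Rightarrow> (('v \<Rightarrow>\<^sub>0 nat) \<times> ('v \<Rightarrow>\<^sub>0 nat)) set" where
  "splittings m = {(a, b). a + b = m}"

lemma finite_splittings [simp]: "finite (splittings m)"
proof -
  let ?A = "{a. \<exists>b. a + b = m}"
  let ?K = "Poly_Mapping.keys m"
  let ?N = "\<Sum>v\<in>?K. Poly_Mapping.lookup m v"
  have "Poly_Mapping.lookup ` ?A \<subseteq>
      {f. \<forall>v. (v \<in> ?K \<longrightarrow> f v \<in> {..?N}) \<and> (v \<notin> ?K \<longrightarrow> f v = 0)}"
  proof clarify
    fix a b v assume m: "m = a + b"
    have le: "Poly_Mapping.lookup a v \<le> Poly_Mapping.lookup m v"
      by (simp add: m lookup_add)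
    moreover have "Poly_Mapping.lookup m v \<le> ?N" if "v \<in> ?K"
      using that by (intro member_le_sum) auto
    ultimately show "(v \<in> Poly_Mapping.keys (a + b) \<longrightarrow>
          Poly_Mapping.lookup a v \<in> {..\<Sum>v\<in>Poly_Mapping.keys (a + b). Poly_Mapping.lookup (a + b) v}) \<and>
        (v \<notin> Poly_Mapping.keys (a + b) \<longrightarrow> Poly_Mapping.lookup a v = 0)"
      using in_keys_iff[of v m] unfolding m by (metis atMost_iff le_trans le_zero_eq)
  qed
  then have "finite (Poly_Mapping.lookup ` ?A)"
    by (rule finite_subset) (rule finite_set_of_finite_funs, auto)
  then have fin: "finite ?A"
    by (rule finite_imageD) (simp add: inj_on_def poly_mapping.lookup_inject)
  have "splittings m \<subseteq> ?A \<times> ?A"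
  proof clarify
    fix a b assume "(a, b) \<in> splittings m"
    then have "a + b = m" and "b + a = m"
      by (simp_all add: splittings_def add.commute)
    then show "a \<in> ?A \<and> b \<in> ?A"
      by blast
  qed
  then show ?thesis
    by (rule finite_subset) (intro finite_cartesian_product fin)
qed

lemma splittings_assoc:
  "(\<Sum>(c, d)\<in>splittings m. \<Sum>(a, b)\<in>splittings c. F a b d)
    = (\<Sum>(a, c)\<in>splittings m. \<Sum>(b, d)\<in>splittings c. F a b d)"
proof -
  have "(\<Sum>(c, d)\<in>splittings m. \<Sum>(a, b)\<in>splittings c. F a b d)
      = (\<Sum>s\<in>splittings m. \<Sum>r\<in>splittings (fst s). F (fst r) (snd r) (snd s))"
    by (simp only: case_prod_unfold)
  also have "\<dots> = (\<Sum>(s, r)\<in>(SIGMA s:splittings m. splittings (fst s)). F (fst r) (snd r) (snd s))"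
    by (rule sum.Sigma) simp_all
  also have "\<dots> = (\<Sum>(s, r)\<in>(SIGMA s:splittings m. splittings (snd s)). F (fst s) (fst r) (snd r))"
    by (rule sum.reindex_bij_witness
          [of _ "\<lambda>(s, r). ((fst s + fst r, snd r), (fst s, fst r))"
                "\<lambda>(s, r). ((fst r, snd r + snd s), (snd r, snd s))"])
       (auto simp: splittings_def add.assoc)
  also have "\<dots> = (\<Sum>s\<in>splittings m. \<Sum>r\<in>splittings (snd s). F (fst s) (fst r) (snd r))"
    by (rule sum.Sigma[symmetric]) simp_all
  also have "\<dots> = (\<Sum>(a, c)\<in>splittings m. \<Sum>(b, d)\<in>splittings c. F a b d)"
    by (simp only: case_prod_unfold)
  finally show ?thesis .
qed

lemma splittings_commute:
  "(\<Sum>(a, b)\<in>splittings m. F a b) = (\<Sum>(a, b)\<in>splittings m. F b a)"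
  by (rule sum.reindex_bij_witness[of _ prod.swap prod.swap])
     (auto simp: splittings_def add.commute)

instantiation mfps :: (type, comm_ring_1) comm_ring_1
begin

definition zero_mfps :: "('a, 'b) mfps" where
  "0 = Abs_mfps (\<lambda>_. 0)"
definition one_mfps :: "('a, 'b) mfps" where
  "1 = Abs_mfps (\<lambda>m. if m = 0 then 1 else 0)"
definition plus_mfps :: "('a, 'b) mfps \<Rightarrow> ('a, 'b) mfps \<Rightarrow> ('a, 'b) mfps" where
  "f + g = Abs_mfps (\<lambda>m. mcoeff f m + mcoeff g m)"
definition uminus_mfps :: "('a, 'b) mfps \<Rightarrow> ('a, 'b) mfps" where
  "- f = Abs_mfps (\<lambda>m. - mcoeff f m)"
definition minus_mfps :: "('a, 'b) mfps \<Rightarrow> ('a, 'b) mfps \<Rightarrow> ('a, 'b) mfps" where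
  "f - g = Abs_mfps (\<lambda>m. mcoeff f m - mcoeff g m)"
definition times_mfps :: "('a, 'b) mfps \<Rightarrow> ('a, 'b) mfps \<Rightarrow> ('a, 'b) mfps" where
  "f * g = Abs_mfps (\<lambda>m. \<Sum>(a, b)\<in>splittings m. mcoeff f a * mcoeff g b)"

instance
proof
  fix f g h :: "('a, 'b) mfps"
  show "f * g * h = f * (g * h)"
  proof (rule mfps_eqI)
    fix m
    have "mcoeff (f * g * h) m
        = (\<Sum>(c, d)\<in>splittings m. \<Sum>(a, b)\<in>splittings c. mcoeff f a * mcoeff g b * mcoeff h d)"
      by (simp add: times_mfps_def sum_distrib_right case_prod_unfold)
    also have "\<dots> = (\<Sum>(a, c)\<in>splittings m. \<Sum>(b, d)\<in>splittings c. mcoeff f a * mcoeff g b * mcoeff h d)"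
      by (rule splittings_assoc)
    also have "\<dots> = mcoeff (f * (g * h)) m"
      by (simp add: times_mfps_def sum_distrib_left case_prod_unfold mult.assoc)
    finally show "mcoeff (f * g * h) m = mcoeff (f * (g * h)) m" .
  qed
  show "f * g = g * f"
    unfolding times_mfps_def
    by (subst splittings_commute) (simp add: mult.commute)
  show "1 * f = f"
  proof (rule mfps_eqI)
    fix m
    have "mcoeff (1 * f) m
        = (\<Sum>s\<in>splittings m. if s = (0, m) then mcoeff f m else 0)"
      unfolding times_mfps_def one_mfps_def mcoeff_Abs_mfps
    proof (rule sum.cong[OF refl])
      fix s assume "s \<in> splittings m"
      then obtain a b where s: "s = (a, b)" and m: "m = a + b"
        by (auto simp: splittings_def)
      show "(case s of (a, b) \<Rightarrow> (if a = 0 then 1 else 0) * mcoeff f b)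
          = (if s = (0, m) then mcoeff f m else 0)"
        by (cases "a = 0") (simp_all add: s m)
    qed
    also have "\<dots> = mcoeff f m"
      by (subst sum.delta[OF finite_splittings]) (auto simp: splittings_def)
    finally show "mcoeff (1 * f) m = mcoeff f m" .
  qed
  show "(f + g) * h = f * h + g * h"
    by (rule mfps_eqI)
       (simp add: times_mfps_def plus_mfps_def case_prod_unfold distrib_right sum.distrib)
  have "mcoeff (0 :: ('a, 'b) mfps) 0 \<noteq> mcoeff 1 0"
    by (simp add: zero_mfps_def one_mfps_def)
  then show "(0 :: ('a, 'b) mfps) \<noteq> 1"
    by auto
  show "f + g + h = f + (g + h)" by (simp add: plus_mfps_def add.assoc)
  show "f + g = g + f" by (simp add: plus_mfps_def add.commute)
  show "0 + f = f" by (simp add: plus_mfps_def zero_mfps_def mcoeff_inverse)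
  show "- f + f = 0" by (simp add: plus_mfps_def zero_mfps_def uminus_mfps_def)
  show "f - g = f + - g" by (simp add: plus_mfps_def minus_mfps_def uminus_mfps_def)
qed

end

definition mconst :: "'a::comm_ring_1 \<Rightarrow> ('v, 'a) mfps" where
  "mconst r = Abs_mfps (\<lambda>m. if m = 0 then r else 0)"

definition mvar :: "'v \<Rightarrow> ('v, 'a::comm_ring_1) mfps" where
  "mvar v = Abs_mfps (\<lambda>m. if m = Poly_Mapping.single v 1 then 1 else 0)"

text \<open>
  Quotients are only meaningful when the denominator is not a zero divisor and divides the
  numerator. The denominators used below are series with constant term 1 (units) and
  differences of two distinct variables.
\<close>

definition mquot :: "('v, 'a::comm_ring_1) mfps \<Rightarrow> ('v, 'a) mfps \<Rightarrow> ('v, 'a) mfps" where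
  "mquot f g = (THE h. h * g = f)"

text \<open>
  Sum of a family in which every monomial has a nonzero coefficient in only finitely many members.
\<close>

definition msuminf :: "(nat \<Rightarrow> ('v, 'a::comm_ring_1) mfps) \<Rightarrow> ('v, 'a) mfps" where
  "msuminf F = Abs_mfps (\<lambda>m. Sum_any (\<lambda>k. mcoeff (F k) m))"

text \<open>
  Substitution of the variable \<open>\<sigma> v\<close> for \<open>v\<close>, for an involution \<open>\<sigma>\<close>.
\<close>

definition mswap :: "('v \<Rightarrow> 'v) \<Rightarrow> ('v, 'a) mfps \<Rightarrow> ('v, 'a) mfps" where
  "mswap \<sigma> f = Abs_mfps (\<lambda>m. mcoeff f (Poly_Mapping.map_key \<sigma> m))"


section \<open>Double Grothendieck polynomials\<close>

datatype var = XVar nat | YVar nat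

text \<open>
  The coefficient ring \<open>\<int>[\<beta>]\<close> is \<^typ>\<open>int poly\<close>, with \<open>\<beta>\<close> the polynomial variable.
\<close>

type_synonym xy_series = "(var, int poly) mfps"

abbreviation xv :: "nat \<Rightarrow> xy_series" where "xv i \<equiv> mvar (XVar i)"
abbreviation yv :: "nat \<Rightarrow> xy_series" where "yv i \<equiv> mvar (YVar i)"
abbreviation bet :: xy_series where "bet \<equiv> mconst [:0, 1:]"

definition isobaric :: "nat \<Rightarrow> xy_series \<Rightarrow> xy_series" where
  "isobaric i f =
     mquot ((1 + bet * xv (i + 1)) * f - (1 + bet * xv i) * mswap (transpose (XVar i) (XVar (i + 1))) f)
           (xv i - xv (i + 1))"

text \<open>
  Permutations of the positive integers with finite support are functions \<^typ>\<open>nat \<Rightarrow> nat\<close> that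
  permute some \<open>{1..n}\<close>; in particular they fix \<open>0\<close>.
\<close>

definition longest_perm :: "nat \<Rightarrow> nat \<Rightarrow> nat" where
  "longest_perm n k = (if k \<in> {1..n} then n + 1 - k else k)"

inductive is_double_grothendieck :: "(nat \<Rightarrow> nat) \<Rightarrow> xy_series \<Rightarrow> bool" where
  longest: "is_double_grothendieck (longest_perm n)
     (\<Prod>(i, j)\<in>{(i, j). 1 \<le> i \<and> 1 \<le> j \<and> i + j \<le> n}. mquot (xv i - yv j) (1 + bet * yv j))"
| descent: "is_double_grothendieck w f \<Longrightarrow> 1 \<le> i \<Longrightarrow> w i > w (i + 1) \<Longrightarrow>
     is_double_grothendieck (w \<circ> transpose i (i + 1)) (isobaric i f)"

text \<open>
  The inductive rules determine exactly one series for every permutation: the result depends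
  neither on \<open>n\<close> nor on the chosen sequence of descents.
\<close>

definition double_grothendieck :: "(nat \<Rightarrow> nat) \<Rightarrow> xy_series" where
  "double_grothendieck w = (THE f. is_double_grothendieck w f)"


section \<open>321-avoiding permutations and the determinant\<close>

definition avoids_321 :: "(nat \<Rightarrow> nat) \<Rightarrow> bool" where
  "avoids_321 w \<longleftrightarrow> \<not> (\<exists>a b c. 1 \<le> a \<and> a < b \<and> b < c \<and> w a > w b \<and> w b > w c)"

definition associated :: "nat \<Rightarrow> (nat \<Rightarrow> nat) \<Rightarrow> (nat \<Rightarrow> nat) \<Rightarrow> (nat \<Rightarrow> nat) \<Rightarrow> bool" where
  "associated t p q w \<longleftrightarrow>
     (\<forall>i\<in>{1..t}. w (p i) = q i + 1) \<and>
     strict_mono_on ({1..} - p ` {1..t}) w \<and>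
     w ` ({1..} - p ` {1..t}) = {1..} - (\<lambda>i. q i + 1) ` {1..t}"

definition skew_outer :: "nat \<Rightarrow> (nat \<Rightarrow> nat) \<Rightarrow> nat \<Rightarrow> int" where
  "skew_outer t q i = int (q i) - int t + int i"

definition skew_inner :: "nat \<Rightarrow> (nat \<Rightarrow> nat) \<Rightarrow> nat \<Rightarrow> int" where
  "skew_inner t p j = int (p j) - (int t + 1 - int j)"

text \<open>
  \<open>gchoose\<close> is constrained to fields, hence this integer version; the division is exact.
\<close>

definition int_binomial :: "int \<Rightarrow> nat \<Rightarrow> int" where
  "int_binomial s k = (\<Prod>i<k. s - int i) div fact k"

text \<open>
  Matrix indices start at 0, whereas the parts of \<open>lam\<close> and \<open>mu\<close> and the arguments \<open>i\<close>, \<open>j\<close>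
  of \<open>c m i j\<close> are numbered from 1.
\<close>

definition skew_Delta ::
  "nat \<Rightarrow> (nat \<Rightarrow> int) \<Rightarrow> (nat \<Rightarrow> int) \<Rightarrow> (int \<Rightarrow> nat \<Rightarrow> nat \<Rightarrow> xy_series) \<Rightarrow> xy_series" where
  "skew_Delta t lam mu c = det (mat t t (\<lambda>(i', j').
     let i = i' + 1; j = j' + 1 in
       msuminf (\<lambda>k. of_int (int_binomial (lam i - mu j + int k - 1) k) * bet ^ k
                      * c (lam i - mu j + int j - int i + int k) i j)))"

text \<open>
  \<open>c(i, j)\<close> is expanded in powers of the \<open>x\<close> and \<open>y\<close> variables over the coefficient ring
  \<open>\<int>[\<beta>][u]\<close>, i.e. \<^typ>\<open>int poly poly\<close> with \<open>u\<close> the outer variable.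
\<close>

definition c_series :: "(nat \<Rightarrow> nat) \<Rightarrow> (nat \<Rightarrow> nat) \<Rightarrow> nat \<Rightarrow> nat \<Rightarrow> (var, int poly poly) mfps" where
  "c_series p q i j =
     (let b = mconst [:[:0, 1:]:]; u = mconst [:0, 1:]; xx = (\<lambda>a. mvar (XVar a)); yy = (\<lambda>a. mvar (YVar a)) in
       (\<Prod>a\<in>{1..q i}. mquot (1 + b * yy a - u * yy a) (1 + b * yy a)) *
       (\<Prod>a\<in>{1..p j}. mquot (1 + b * xx a) (1 + b * xx a - u * xx a)))"

definition c_coeff :: "(nat \<Rightarrow> nat) \<Rightarrow> (nat \<Rightarrow> nat) \<Rightarrow> int \<Rightarrow> nat \<Rightarrow> nat \<Rightarrow> xy_series" where
  "c_coeff p q m i j =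
     (if m < 0 then 0
      else Abs_mfps (\<lambda>e. poly.coeff (mcoeff (c_series p q i j) e) (nat m)))"

end

theory Submission
  imports Defs
begin

text \<open>
  The divided difference \<open>\<pi>\<^sub>p\<close> turns \<open>(1 + \<beta>x\<^sub>p) / (1 + \<beta>x\<^sub>p - ux\<^sub>p)\<close> into the product of this factor,
  the same factor for \<open>x\<^bsub>p+1\<^esub>\<close>, and \<open>u - \<beta>\<close>. Hence it maps the entries of a column with \<open>p\<^sub>j = p\<close> to
  those with \<open>p\<^sub>j = p + 1\<close>, and if \<open>p + 1\<close> is not among the \<open>p\<^sub>l\<close>, all other columns are
  symmetric in \<open>x\<^sub>p, x\<^bsub>p+1\<^esub>\<close>. So every determinant comes from the one for the minimal positions
  \<open>p\<^sub>j = t + 1 - j\<close>, where \<open>w\<close> is Grassmannian.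
  With \<open>f\<^sub>i(x) = \<Prod>\<^bsub>b \<le> q\<^sub>i\<^esub> (x - y\<^sub>b) / (1 + \<beta>y\<^sub>b)\<close>, its entries are the divided differences in
  \<open>\<xi> = x / (1 + \<beta>x)\<close> of \<open>(1 + \<beta>x)\<^bsup>i-t\<^esup> f\<^sub>i(x)\<close>; a common factor \<open>\<phi>(x)\<close> of all the functions
  comes out of the determinant as \<open>\<phi>(x\<^sub>1) \<cdots> \<phi>(x\<^sub>t)\<close>. Starting from the dominant permutation
  with the values \<open>q\<^sub>1 + 1 > \<cdots> > q\<^sub>t + 1\<close> in front, the value \<open>q\<^bsub>r+1\<^esub> + 1\<close> is moved across the
  reversed first \<open>r\<close> values: \<open>f\<^bsub>r+1\<^esub>\<close> divides \<open>f\<^sub>1, \<dots>, f\<^sub>r\<close>, and once extracted it leaves a prefactor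
  that is symmetric in \<open>x\<^sub>1, \<dots>, x\<^bsub>r+1\<^esub>\<close>, so that again only columns move.
  That the recursion for \<open>G\<^sub>w\<close> is consistent follows from the braid relations for the \<open>\<pi>\<^sub>i\<close> and from
  the product formula for dominant permutations.
\<close>

section \<open>Arithmetic of power series\<close>


lemma mcoeff_simps [simp]:
  "mcoeff 0 m = 0" "mcoeff 1 m = (if m = 0 then 1 else 0)"
  "mcoeff (f + g) m = mcoeff f m + mcoeff g m"
  "mcoeff (f - g) m = mcoeff f m - mcoeff g m"
  "mcoeff (- f) m = - mcoeff f m"
  for f g :: "('v, 'a::comm_ring_1) mfps"
  by (simp_all add: zero_mfps_def one_mfps_def plus_mfps_def minus_mfps_def uminus_mfps_def)

lemma mcoeff_mult: "mcoeff (f * g) m = (\<Sum>(a, b)\<in>splittings m. mcoeff f a * mcoeff g b)"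
  for f g :: "('v, 'a::comm_ring_1) mfps"
  by (simp add: times_mfps_def)

text \<open>Common source of the rules for multiplying by a constant (\<open>e = 0\<close>) and by a
  variable (\<open>e = unit_exp v\<close>).\<close>

lemma mcoeff_monomial_mult:
  fixes f g :: "('v, 'a::comm_ring_1) mfps"
  assumes "\<And>m. mcoeff f m = (if m = e then r else 0)"
  shows "mcoeff (f * g) (e + m) = r * mcoeff g m"
    and "(\<And>m. n \<noteq> e + m) \<Longrightarrow> mcoeff (f * g) n = 0"
proof -
  have "mcoeff (f * g) (e + m) = (\<Sum>s\<in>splittings (e + m). if s = (e, m) then r * mcoeff g m else 0)"
    unfolding mcoeff_mult
  proof (rule sum.cong[OF refl])
    fix s assume "s \<in> splittings (e + m)"
    then obtain a b where "s = (a, b)" "a + b = e + m"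
      by (auto simp: splittings_def)
    then show "(case s of (a, b) \<Rightarrow> mcoeff f a * mcoeff g b) = (if s = (e, m) then r * mcoeff g m else 0)"
      by (cases "a = e") (simp_all add: assms)
  qed
  also have "\<dots> = r * mcoeff g m"
    by (subst sum.delta[OF finite_splittings]) (auto simp: splittings_def)
  finally show "mcoeff (f * g) (e + m) = r * mcoeff g m" .
next
  assume "\<And>m. n \<noteq> e + m"
  then show "mcoeff (f * g) n = 0"
    unfolding mcoeff_mult
    by (intro sum.neutral) (auto simp: assms splittings_def)
qed

lemma mcoeff_mconst_mult [simp]: "mcoeff (mconst r * f) m = r * mcoeff f m"
  using mcoeff_monomial_mult(1)[of "mconst r" 0 r f m] by (simp add: mconst_def)

abbreviation unit_exp :: "'v \<Rightarrow> 'v \<Rightarrow>\<^sub>0 nat" where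
  "unit_exp v \<equiv> Poly_Mapping.single v (Suc 0)"

lemma mcoeff_mvar_mult:
  fixes f :: "('v, 'a::comm_ring_1) mfps"
  shows
  "mcoeff (mvar v * f) (unit_exp v + m) = mcoeff f m"
  "Poly_Mapping.lookup n v = 0 \<Longrightarrow> mcoeff (mvar v * f) n = 0"
proof -
  have v: "mcoeff (mvar v :: ('v, 'a) mfps) m = (if m = unit_exp v then 1 else 0)" for m
    by (simp add: mvar_def)
  show "mcoeff (mvar v * f) (unit_exp v + m) = mcoeff f m"
    using mcoeff_monomial_mult(1)[OF v, of f m] by simp
  show "mcoeff (mvar v * f) n = 0" if "Poly_Mapping.lookup n v = 0"
    by (rule mcoeff_monomial_mult(2)[OF v]) (use that in \<open>auto simp: lookup_add\<close>)
qed

lemma exp_cases: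
  obtains "Poly_Mapping.lookup n v = 0" | m where "n = unit_exp v + m"
proof (cases "Poly_Mapping.lookup n v = 0")
  case False
  have "n = unit_exp v + (n - unit_exp v)"
    by (rule poly_mapping_eqI) (use False in \<open>auto simp: lookup_add lookup_minus lookup_single when_def\<close>)
  then show ?thesis using that by blast
qed

lemma mconst_hom:
  "mconst (a + b) = (mconst a + mconst b :: ('v, 'a::comm_ring_1) mfps)"
  "mconst (a - b) = (mconst a - mconst b :: ('v, 'a::comm_ring_1) mfps)"
  "mconst (- a) = (- mconst a :: ('v, 'a::comm_ring_1) mfps)"
  "mconst (a * b) = (mconst a * mconst b :: ('v, 'a::comm_ring_1) mfps)"
  "mconst 0 = (0 :: ('v, 'a::comm_ring_1) mfps)" "mconst 1 = (1 :: ('v, 'a::comm_ring_1) mfps)"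
proof -
  show "mconst (a * b) = (mconst a * mconst b :: ('v, 'a::comm_ring_1) mfps)"
    by (rule mfps_eqI, simp only: mcoeff_mconst_mult) (simp add: mconst_def)
qed (auto intro!: mfps_eqI simp: mconst_def)

lemma mconst_power: "mconst (a ^ k) = mconst a ^ k"
  by (induction k) (simp_all add: mconst_hom)

lemma mconst_of_int: "mconst (of_int k) = of_int k"
proof -
  have nat: "mconst (of_nat n) = of_nat n" for n
    by (induction n) (simp_all add: mconst_hom)
  show ?thesis by (cases k) (simp_all add: mconst_hom nat)
qed

text \<open>Coefficients along the line of monomials \<open>m x\<^sup>i y\<^sup>j\<close> with fixed \<open>i + j\<close> telescope.\<close>

lemma mult_var_diff_cancel:
  fixes h :: "('v, 'a::comm_ring_1) mfps"
  assumes "v \<noteq> w" "h * (mvar v - mvar w) = 0"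
  shows "h = 0"
proof (rule mfps_eqI)
  have eq: "mvar v * h = mvar w * h"
    using assms(2) by (simp add: algebra_simps)
  have "mcoeff h m = 0" if "Poly_Mapping.lookup m w = d" for m d
    using that
  proof (induction d arbitrary: m)
    case 0
    have "mcoeff h m = mcoeff (mvar w * h) (unit_exp v + m)"
      unfolding eq[symmetric] by (simp add: mcoeff_mvar_mult)
    also have "\<dots> = 0"
      by (rule mcoeff_mvar_mult(2)) (use 0 assms in \<open>simp add: lookup_add lookup_single\<close>)
    finally show ?case .
  next
    case (Suc d)
    then obtain m' where m: "m = unit_exp w + m'"
      by (cases m w rule: exp_cases) auto
    have "mcoeff h m = mcoeff (mvar w * h) (unit_exp v + m)"
      unfolding eq[symmetric] by (simp add: mcoeff_mvar_mult)
    also have "\<dots> = mcoeff h (unit_exp v + m')"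
      unfolding m by (metis mcoeff_mvar_mult(1) add.left_commute)
    also have "\<dots> = 0"
      by (rule Suc.IH) (use Suc.prems assms m in \<open>simp add: lookup_add lookup_single\<close>)
    finally show ?case .
  qed
  then show "mcoeff h m = mcoeff 0 m" for m
    by simp
qed

lemma mult_var_diff_cancel_eq:
  fixes f g :: "('v, 'a::comm_ring_1) mfps"
  assumes "v \<noteq> w" "f * (mvar v - mvar w) = g * (mvar v - mvar w)"
  shows "f = g"
  using mult_var_diff_cancel[OF assms(1), of "f - g"] assms(2) by (simp add: left_diff_distrib)

section \<open>Substitution of variables by an involution\<close>

definition involution :: "('v \<Rightarrow> 'v) \<Rightarrow> bool" where
  "involution \<sigma> \<longleftrightarrow> (\<forall>v. \<sigma> (\<sigma> v) = v)"

lemma involution_transpose [simp]: "involution (transpose a b)"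
  by (simp add: involution_def)

lemma involution_inj: "involution \<sigma> \<Longrightarrow> inj \<sigma>"
  unfolding involution_def by (metis injI)

lemma map_key_involution:
  assumes "involution \<sigma>"
  shows "Poly_Mapping.map_key \<sigma> (Poly_Mapping.map_key \<sigma> m) = m"
  using assms involution_inj[OF assms]
  by (intro poly_mapping_eqI) (simp add: map_key.rep_eq involution_def)

lemma lookup_map_key_involution:
  "involution \<sigma> \<Longrightarrow> Poly_Mapping.lookup (Poly_Mapping.map_key \<sigma> m) v = Poly_Mapping.lookup m (\<sigma> v)"
  by (simp add: map_key.rep_eq involution_inj)

lemma mcoeff_mswap [simp]: "mcoeff (mswap \<sigma> f) m = mcoeff f (Poly_Mapping.map_key \<sigma> m)"
  by (simp add: mswap_def)

lemma mswap_hom: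
  fixes f g :: "('v, 'a::comm_ring_1) mfps"
  assumes \<sigma>: "involution \<sigma>"
  shows "mswap \<sigma> (f + g) = mswap \<sigma> f + mswap \<sigma> g" "mswap \<sigma> (f - g) = mswap \<sigma> f - mswap \<sigma> g"
    "mswap \<sigma> (- f) = - mswap \<sigma> f" "mswap \<sigma> (f * g) = mswap \<sigma> f * mswap \<sigma> g"
    "mswap \<sigma> (0 :: ('v, 'a) mfps) = 0" "mswap \<sigma> (mconst c :: ('v, 'a) mfps) = mconst c"
    "mswap \<sigma> (mvar v :: ('v, 'a) mfps) = mvar (\<sigma> v)"
    "mswap \<sigma> (1 :: ('v, 'a) mfps) = 1"
    "mswap \<sigma> (mswap \<sigma> f) = f"
proof -
  let ?k = "Poly_Mapping.map_key \<sigma>"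
  note [simp] = map_key_involution[OF \<sigma>] map_key_plus[OF involution_inj[OF \<sigma>]]
    map_key_zero[OF involution_inj[OF \<sigma>]]
  have k0: "?k m = 0 \<longleftrightarrow> m = 0" for m :: "'v \<Rightarrow>\<^sub>0 nat"
    by (metis map_key_involution[OF \<sigma>] map_key_zero[OF involution_inj[OF \<sigma>]])
  show "mswap \<sigma> (f * g) = mswap \<sigma> f * mswap \<sigma> g"
  proof (rule mfps_eqI)
    fix m
    show "mcoeff (mswap \<sigma> (f * g)) m = mcoeff (mswap \<sigma> f * mswap \<sigma> g) m"
      unfolding mcoeff_mult mcoeff_mswap
      by (rule sum.reindex_bij_witness[of _ "map_prod ?k ?k" "map_prod ?k ?k"])
        (auto simp: splittings_def simp flip: map_key_plus[OF involution_inj[OF \<sigma>]])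
  qed
  show const: "mswap \<sigma> (mconst c :: ('v, 'a) mfps) = mconst c" for c
    by (rule mfps_eqI) (simp add: mconst_def k0)
  show "mswap \<sigma> (1 :: ('v, 'a) mfps) = 1"
    using const[of 1] by (simp add: mconst_hom)
  have "?k m = unit_exp v \<longleftrightarrow> m = unit_exp (\<sigma> v)" for m
    using \<sigma> map_key_single[OF involution_inj[OF \<sigma>], of "\<sigma> v" "Suc 0"]
      map_key_single[OF involution_inj[OF \<sigma>], of v "Suc 0"]
    unfolding involution_def by (metis map_key_involution[OF \<sigma>])
  then show "mswap \<sigma> (mvar v :: ('v, 'a) mfps) = mvar (\<sigma> v)"
    by (intro mfps_eqI) (simp add: mvar_def)
  show "mswap \<sigma> (mswap \<sigma> f) = f"
    by (rule mfps_eqI) simp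
qed (rule mfps_eqI; simp)+

lemma mswap_prod: "involution \<sigma> \<Longrightarrow> mswap \<sigma> (prod f A) = (\<Prod>a\<in>A. mswap \<sigma> (f a))"
  by (induction A rule: infinite_finite_induct) (simp_all add: mswap_hom)

lemma mswap_sum: "involution \<sigma> \<Longrightarrow> mswap \<sigma> (sum f A) = (\<Sum>a\<in>A. mswap \<sigma> (f a))"
  by (induction A rule: infinite_finite_induct) (simp_all add: mswap_hom)

text \<open>The quotient of \<open>g = f - \<sigma> f\<close> by \<open>x - y\<close> has \<open>x\<^sup>c y\<^sup>d\<close>-coefficient
  \<open>\<Sum>k\<le>d. g\<^bsub>c+1+k, d-k\<^esub>\<close>.\<close>

lemma var_diff_dvd:
  fixes f :: "('v, 'a::comm_ring_1) mfps"
  assumes "v \<noteq> w"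
  shows "\<exists>h. h * (mvar v - mvar w) = f - mswap (transpose v w) f"
proof -
  define g where "g = f - mswap (transpose v w) f"
  let ?e = "\<lambda>v n. Poly_Mapping.single v (n::nat)"
  let ?l = "\<lambda>m. Poly_Mapping.lookup m w"
  let ?\<sigma> = "Poly_Mapping.map_key (transpose v w)"
  define h where "h = Abs_mfps (\<lambda>m. \<Sum>k\<le>?l m. mcoeff g (?e v (Suc k) + (m - ?e w k)))"
  have anti: "mcoeff g (?\<sigma> m) = - mcoeff g m" for m
    unfolding g_def by (simp add: map_key_involution)
  have "mcoeff (h * (mvar v - mvar w)) m = mcoeff g m" for m
  proof -
    have "h * (mvar v - mvar w) = mvar v * h - mvar w * h"
      by (simp add: algebra_simps)
    then have *: "mcoeff (h * (mvar v - mvar w)) m = mcoeff (mvar v * h) m - mcoeff (mvar w * h) m"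
      by simp
    have w: "mcoeff (mvar w * h) m = (\<Sum>k<?l m. mcoeff g (?e v (Suc k) + (m - ?e w (Suc k))))"
    proof (cases m w rule: exp_cases)
      case 1
      then show ?thesis by (simp add: mcoeff_mvar_mult(2))
    next
      case (2 m')
      have "mcoeff (mvar w * h) m = mcoeff h m'"
        unfolding 2 by (rule mcoeff_mvar_mult)
      also have "\<dots> = (\<Sum>k<?l m. mcoeff g (?e v (Suc k) + (m' - ?e w k)))"
        by (simp add: h_def 2 lookup_add lessThan_Suc_atMost)
      also have "\<dots> = (\<Sum>k<?l m. mcoeff g (?e v (Suc k) + (m - ?e w (Suc k))))"
      proof (rule sum.cong[OF refl])
        fix k
        have "m' - ?e w k = m - ?e w (Suc k)"
          by (rule poly_mapping_eqI) (auto simp: 2 lookup_add lookup_minus lookup_single when_def)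
        then show "mcoeff g (?e v (Suc k) + (m' - ?e w k)) = mcoeff g (?e v (Suc k) + (m - ?e w (Suc k)))"
          by simp
      qed
      finally show ?thesis .
    qed
    show ?thesis
    proof (cases m v rule: exp_cases)
      case (2 m')
      have "mcoeff (mvar v * h) m = mcoeff h m'"
        unfolding 2 by (rule mcoeff_mvar_mult)
      also have "\<dots> = (\<Sum>k\<le>?l m. mcoeff g (?e v (Suc k) + (m' - ?e w k)))"
        using assms by (simp add: h_def 2 lookup_add lookup_single)
      also have "\<dots> = (\<Sum>k\<le>?l m. mcoeff g (?e v k + (m - ?e w k)))"
      proof (rule sum.cong[OF refl])
        fix k
        have "?e v (Suc k) + (m' - ?e w k) = ?e v k + (m - ?e w k)"
          using assms by (intro poly_mapping_eqI) (auto simp: 2 lookup_add lookup_minus lookup_single when_def)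
        then show "mcoeff g (?e v (Suc k) + (m' - ?e w k)) = mcoeff g (?e v k + (m - ?e w k))"
          by simp
      qed
      also have "\<dots> = mcoeff g m + (\<Sum>k<?l m. mcoeff g (?e v (Suc k) + (m - ?e w (Suc k))))"
        by (cases "?l m") (simp_all add: sum.atMost_shift)
      finally show ?thesis using * w by simp
    next
      case 1
      let ?t = "\<lambda>k. ?e v k + (m - ?e w k)"
      have swap: "?\<sigma> (?t k) = ?t (?l m - k)" if "k \<le> ?l m" for k
        using 1 assms that
        by (intro poly_mapping_eqI)
          (auto simp: lookup_map_key_involution lookup_add lookup_minus lookup_single when_def transpose_def)
      have v0: "mcoeff (mvar v * h) m = 0"
        using 1 by (rule mcoeff_mvar_mult(2))
      \<comment> \<open>The transposition reverses the sequence \<open>?t\<close>, so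
        \<open>f\<close> and its swap have the same sum. Antisymmetry of \<open>g\<close> alone
        would only show that twice the sum vanishes.\<close>
      have zero: "(\<Sum>k\<le>?l m. mcoeff g (?t k)) = 0"
      proof -
        have "(\<Sum>k\<le>?l m. mcoeff f (?\<sigma> (?t k))) = (\<Sum>k\<le>?l m. mcoeff f (?t (?l m - k)))"
          by (rule sum.cong) (auto simp: swap)
        also have "\<dots> = (\<Sum>k\<le>?l m. mcoeff f (?t k))"
          by (rule sum.reindex_bij_witness[of _ "\<lambda>k. ?l m - k" "\<lambda>k. ?l m - k"]) auto
        finally show ?thesis
          by (simp add: g_def sum_subtractf)
      qed
      also have "(\<Sum>k\<le>?l m. mcoeff g (?t k)) = mcoeff g m + (\<Sum>k<?l m. mcoeff g (?t (Suc k)))"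
        by (cases "?l m") (simp_all add: sum.atMost_shift)
      finally have "mcoeff g m = - (\<Sum>k<?l m. mcoeff g (?t (Suc k)))"
        by (simp add: eq_neg_iff_add_eq_0)
      then show ?thesis using * w v0 by simp
    qed
  qed
  then show ?thesis
    by (intro exI[of _ h] mfps_eqI) (simp add: g_def)
qed

text \<open>The expansion of \<open>1 / (1 - c v)\<close>; the condition on \<open>m\<close> says
  that it is a power of \<open>v\<close>. The unit denominators are the cases
  \<open>c = - \<beta>\<close> and \<open>c = u - \<beta>\<close>.\<close>

definition geo :: "'v \<Rightarrow> 'a::comm_ring_1 \<Rightarrow> ('v, 'a) mfps" where
  "geo v c = Abs_mfps (\<lambda>m. if m = Poly_Mapping.single v (Poly_Mapping.lookup m v)
     then c ^ Poly_Mapping.lookup m v else 0)"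

lemma geo_inverse: "(1 - mconst c * mvar v) * geo v c = 1"
proof -
  have "geo v c = 1 + mconst c * (mvar v * geo v c)"
  proof (rule mfps_eqI)
    fix m
    show "mcoeff (geo v c) m = mcoeff (1 + mconst c * (mvar v * geo v c)) m"
    proof (cases m v rule: exp_cases)
      case 1
      have "m = Poly_Mapping.single v (Poly_Mapping.lookup m v) \<longleftrightarrow> m = 0" unfolding 1 by simp
      then show ?thesis
        using 1 by (simp add: geo_def mcoeff_mvar_mult)
    next
      case (2 m')
      have nz: "m \<noteq> 0"
      proof
        assume "m = 0"
        then have "Poly_Mapping.lookup (unit_exp v + m') v = 0" by (simp add: 2)
        then show False by (simp add: lookup_add)
      qed
      have l: "Poly_Mapping.lookup m v = Suc (Poly_Mapping.lookup m' v)"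
        by (simp add: 2 lookup_add)
      have *: "m = Poly_Mapping.single v (Poly_Mapping.lookup m v) \<longleftrightarrow>
          m' = Poly_Mapping.single v (Poly_Mapping.lookup m' v)"
        unfolding l unfolding 2
        using single_add[of v 1 "Poly_Mapping.lookup m' v"] by simp
      have "mcoeff (mvar v * geo v c) m = mcoeff (geo v c) m'"
        unfolding 2 by (rule mcoeff_mvar_mult)
      moreover have "mcoeff (geo v c) m = c * mcoeff (geo v c) m'"
        unfolding geo_def mcoeff_Abs_mfps * by (simp add: l)
      ultimately show ?thesis
        using nz by simp
    qed
  qed
  then show ?thesis
    by (simp add: algebra_simps)
qed

lemma mswap_geo:
  assumes "involution \<sigma>"
  shows "mswap \<sigma> (geo v c) = geo (\<sigma> v) c"
proof -
  have "mswap \<sigma> ((1 - mconst c * mvar v) * geo v c) = 1"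
    using assms by (simp add: geo_inverse mswap_hom)
  then have 1: "(1 - mconst c * mvar (\<sigma> v)) * mswap \<sigma> (geo v c) = 1"
    using assms by (simp add: mswap_hom)
  have "geo (\<sigma> v) c * ((1 - mconst c * mvar (\<sigma> v)) * mswap \<sigma> (geo v c))
      = (1 - mconst c * mvar (\<sigma> v)) * geo (\<sigma> v) c * mswap \<sigma> (geo v c)"
    by (simp only: ac_simps)
  then show ?thesis
    by (simp add: 1 geo_inverse)
qed

lemma mquot_unit:
  assumes "g * g' = 1"
  shows "mquot f g = f * g'"
  unfolding mquot_def
proof (rule the_equality)
  show "f * g' * g = f"
    using assms by (simp add: mult.assoc mult.commute[of g'])
  show "h = f * g'" if "h * g = f" for h
    using assms that by (metis mult.assoc mult.right_neutral)
qed


section \<open>Isobaric divided differences\<close>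

abbreviation om :: "nat \<Rightarrow> xy_series" where "om i \<equiv> 1 + bet * xv i"

abbreviation sw :: "nat \<Rightarrow> xy_series \<Rightarrow> xy_series" where
  "sw i \<equiv> mswap (transpose (XVar i) (XVar (Suc i)))"

lemma mswap_mswap:
  assumes "inj \<sigma>" "inj \<tau>"
  shows "mswap \<sigma> (mswap \<tau> f) = mswap (\<sigma> \<circ> \<tau>) f"
  by (rule mfps_eqI) (simp add: map_key_compose assms)

lemma sw_commute:
  assumes "Suc i < j"
  shows "sw i (sw j f) = sw j (sw i f)"
proof -
  have eq: "transpose (XVar i) (XVar (Suc i)) \<circ> transpose (XVar j) (XVar (Suc j))
      = transpose (XVar j) (XVar (Suc j)) \<circ> transpose (XVar i) (XVar (Suc i))"
    using assms by (auto simp: fun_eq_iff transpose_def)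
  show ?thesis
    using arg_cong[OF eq, of "\<lambda>\<sigma>. mswap \<sigma> f"] by (simp only: mswap_mswap inj_transpose)
qed

lemma sw_braid: "sw i (sw (Suc i) (sw i f)) = sw (Suc i) (sw i (sw (Suc i) f))"
proof -
  let ?s = "transpose (XVar i) (XVar (Suc i))" and ?t = "transpose (XVar (Suc i)) (XVar (Suc (Suc i)))"
  have eq: "?s \<circ> (?t \<circ> ?s) = ?t \<circ> (?s \<circ> ?t)"
    by (auto simp: fun_eq_iff transpose_def)
  have "sw i (sw (Suc i) (sw i f)) = mswap (?s \<circ> (?t \<circ> ?s)) f"
    by (simp add: mswap_mswap inj_compose)
  also have "\<dots> = mswap (?t \<circ> (?s \<circ> ?t)) f"
    by (rule arg_cong[OF eq])
  also have "\<dots> = sw (Suc i) (sw i (sw (Suc i) f))"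
    by (simp add: mswap_mswap inj_compose)
  finally show ?thesis .
qed

lemma sw_om [simp]:
  "sw i (om i) = om (Suc i)" "sw i (om (Suc i)) = om i"
  "j \<noteq> i \<Longrightarrow> j \<noteq> Suc i \<Longrightarrow> sw i (om j) = om j"
  by (simp_all add: mswap_hom)

lemma sw_xv [simp]:
  "sw i (xv i) = xv (Suc i)" "sw i (xv (Suc i)) = xv i"
  "j \<noteq> i \<Longrightarrow> j \<noteq> Suc i \<Longrightarrow> sw i (xv j) = xv j"
  by (simp_all add: mswap_hom)

lemma sw_mult: "sw i (f * g) = sw i f * sw i g"
  by (simp add: mswap_hom)

lemma sw_add: "sw i (f + g) = sw i f + sw i g"
  by (simp add: mswap_hom)

lemma sw_diff: "sw i (f - g) = sw i f - sw i g"
  by (simp add: mswap_hom)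

lemma sw_sw [simp]: "sw i (sw i f) = f"
  by (simp add: mswap_hom)

lemma xv_cancel:
  assumes "i \<noteq> j" "f * (xv i - xv j) = g * (xv i - xv j)"
  shows "f = g"
  by (rule mult_var_diff_cancel_eq[OF _ assms(2)]) (use assms(1) in simp)

text \<open>Turns the quotient into an equation: it exists by \<open>var_diff_dvd\<close> for
  \<open>om (Suc i) * f\<close>, and it is unique because \<open>xv i - xv (Suc i)\<close> can be
  cancelled.\<close>

lemma isobaric_mult_diff:
  "isobaric i f * (xv i - xv (Suc i)) = om (Suc i) * f - om i * sw i f"
proof -
  let ?P = "\<lambda>h. h * (xv i - xv (Suc i)) = om (Suc i) * f - om i * sw i f"
  obtain h where "h * (xv i - xv (Suc i)) = om (Suc i) * f - sw i (om (Suc i) * f)"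
    using var_diff_dvd[of "XVar i" "XVar (Suc i)" "om (Suc i) * f"] by auto
  then have h: "?P h"
    by (simp only: sw_mult sw_om)
  have "?P (THE h. ?P h)"
  proof (rule theI[of ?P, OF h])
    show "h' = h" if "?P h'" for h'
      by (rule xv_cancel[of i "Suc i"]) (use that h in simp_all)
  qed
  then show ?thesis
    by (simp add: isobaric_def mquot_def)
qed

lemma isobaric_eqI:
  assumes "h * (xv i - xv (Suc i)) = om (Suc i) * f - om i * sw i f"
  shows "isobaric i f = h"
  by (rule xv_cancel[of i "Suc i"]) (simp_all add: assms isobaric_mult_diff)

lemma isobaric_mult_left:
  assumes "sw i g = g"
  shows "isobaric i (g * f) = g * isobaric i f"
proof (rule isobaric_eqI)
  have "g * isobaric i f * (xv i - xv (Suc i)) = g * (om (Suc i) * f - om i * sw i f)"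
    by (simp only: mult.assoc isobaric_mult_diff)
  then show "g * isobaric i f * (xv i - xv (Suc i)) = om (Suc i) * (g * f) - om i * sw i (g * f)"
    by (simp add: sw_mult assms algebra_simps)
qed

lemma isobaric_add: "isobaric i (f + g) = isobaric i f + isobaric i g"
  by (rule isobaric_eqI) (simp only: sw_add distrib_right isobaric_mult_diff, simp add: algebra_simps)

lemma isobaric_of_sym:
  assumes "sw i f = f"
  shows "isobaric i f = - bet * f"
  by (rule isobaric_eqI) (simp add: assms algebra_simps)

lemma sw_isobaric [simp]: "sw i (isobaric i f) = isobaric i f"
proof (rule xv_cancel[of i "Suc i"])
  have "sw i (isobaric i f * (xv i - xv (Suc i))) = sw i (om (Suc i) * f - om i * sw i f)"
    by (simp only: isobaric_mult_diff)
  then have "sw i (isobaric i f) * (xv (Suc i) - xv i) = om i * sw i f - om (Suc i) * f"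
    by (simp only: sw_diff sw_mult sw_om sw_xv sw_sw)
  also have "\<dots> = - (isobaric i f * (xv i - xv (Suc i)))"
    by (simp only: isobaric_mult_diff minus_diff_eq)
  finally have "- (sw i (isobaric i f) * (xv i - xv (Suc i))) = - (isobaric i f * (xv i - xv (Suc i)))"
    by (simp add: algebra_simps)
  then show "sw i (isobaric i f) * (xv i - xv (Suc i)) = isobaric i f * (xv i - xv (Suc i))"
    by simp
qed simp

lemma sw_isobaric_far:
  assumes "Suc i < j \<or> Suc j < i"
  shows "sw j (isobaric i f) = isobaric i (sw j f)"
proof (rule isobaric_eqI[symmetric])
  have comm: "sw j (sw i f) = sw i (sw j f)"
    using assms sw_commute[of i j f] sw_commute[of j i f] by auto
  have "sw j (isobaric i f * (xv i - xv (Suc i))) = sw j (om (Suc i) * f - om i * sw i f)"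
    by (simp only: isobaric_mult_diff)
  moreover have "sw j (om i) = om i" "sw j (om (Suc i)) = om (Suc i)"
    "sw j (xv i) = xv i" "sw j (xv (Suc i)) = xv (Suc i)"
    using assms by (auto intro!: sw_om(3) sw_xv(3))
  ultimately show "sw j (isobaric i f) * (xv i - xv (Suc i)) = om (Suc i) * sw j f - om i * sw i (sw j f)"
    by (simp only: sw_diff sw_mult comm)
qed

lemma isobaric_commute:
  assumes "Suc i < j"
  shows "isobaric i (isobaric j f) = isobaric j (isobaric i f)"
proof (rule isobaric_eqI, rule xv_cancel[of j "Suc j"])
  let ?d = "xv i - xv (Suc i)" and ?e = "xv j - xv (Suc j)"
  have "isobaric j (isobaric i f) * ?d * ?e = (om (Suc j) * isobaric i f - om j * sw j (isobaric i f)) * ?d"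
    unfolding isobaric_mult_diff[symmetric] by (simp only: ac_simps)
  also have "\<dots> = om (Suc j) * (isobaric i f * ?d) - om j * (isobaric i (sw j f) * ?d)"
    using assms by (simp add: sw_isobaric_far algebra_simps)
  also have "\<dots> = om (Suc i) * (om (Suc j) * f - om j * sw j f) - om i * (om (Suc j) * sw i f - om j * sw j (sw i f))"
    unfolding isobaric_mult_diff sw_commute[OF assms] by (simp only: algebra_simps)
  also have "\<dots> = om (Suc i) * (isobaric j f * ?e) - om i * (isobaric j (sw i f) * ?e)"
    unfolding isobaric_mult_diff ..
  also have "\<dots> = (om (Suc i) * isobaric j f - om i * sw i (isobaric j f)) * ?e"
    using assms by (simp add: sw_isobaric_far algebra_simps)
  finally show "isobaric j (isobaric i f) * ?d * ?e = (om (Suc i) * isobaric j f - om i * sw i (isobaric j f)) * ?e" .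
qed (simp)

text \<open>Both sides equal the signed sum of the six images of \<open>f\<close> divided by the Vandermonde
  product.\<close>

lemma isobaric_braid:
  "isobaric i (isobaric (Suc i) (isobaric i f)) = isobaric (Suc i) (isobaric i (isobaric (Suc i) f))"
proof -
  define a b c where abc: "a = xv i" "b = xv (Suc i)" "c = xv (Suc (Suc i))"
  define p q r where pqr: "p = om i" "q = om (Suc i)" "r = om (Suc (Suc i))"
  let ?s = "sw i" and ?t = "sw (Suc i)"
  have sx: "?s a = b" "?s b = a" "?s c = c" "?t a = a" "?t b = c" "?t c = b"
    "?s p = q" "?s q = p" "?s r = r" "?t p = p" "?t q = r" "?t r = q"
    unfolding abc pqr by (auto intro!: sw_om sw_xv)
  have om: "p = 1 + bet * a" "q = 1 + bet * b" "r = 1 + bet * c"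
    unfolding abc pqr by auto
  have I: "isobaric i h * (a - b) = q * h - p * ?s h" for h
    unfolding abc pqr by (rule isobaric_mult_diff)
  have J: "isobaric (Suc i) h * (b - c) = r * h - q * ?t h" for h
    unfolding abc pqr by (rule isobaric_mult_diff)
  \<comment> \<open>Extracts the factor \<open>a - b\<close> from the terms with \<open>f\<close>
    and \<open>?s f\<close> when \<open>isobaric i\<close> is applied last. The other order works by
    expansion alone.\<close>
  have key: "q * (a - c) - p * (b - c) = (a - b) * r"
    unfolding om by (simp add: algebra_simps)
  let ?V = "(a - b) * (a - c) * (b - c)"
  let ?sum = "q * r * r * f - p * r * r * ?s f - q * q * r * ?t f + p * q * q * ?t (?s f) + p * p * r * ?s (?t f)
    - p * p * q * ?s (?t (?s f))"
  note hom = sw_mult sw_diff sx sw_sw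
  have "isobaric i (isobaric (Suc i) (isobaric i f)) * ?V = ?sum"
  proof -
    define g where "g = isobaric i f"
    define h where "h = isobaric (Suc i) g"
    have g: "g * (a - b) = q * f - p * ?s f"
      unfolding g_def by (rule I)
    have tg: "?t g * (a - c) = r * ?t f - p * ?t (?s f)"
      using arg_cong[OF g, of ?t] by (simp only: hom)
    have "h * ((b - c) * (a - b) * (a - c)) = (h * (b - c)) * (a - b) * (a - c)"
      by (simp only: ac_simps)
    also have "\<dots> = r * (g * (a - b)) * (a - c) - q * (?t g * (a - c)) * (a - b)"
      unfolding h_def J by (simp only: algebra_simps)
    finally have h: "h * ((b - c) * (a - b) * (a - c))
        = r * (q * f - p * ?s f) * (a - c) - q * (r * ?t f - p * ?t (?s f)) * (a - b)"
      unfolding g tg .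
    have sh: "?s h * ((a - c) * (b - a) * (b - c))
        = r * (p * ?s f - q * f) * (b - c) - p * (r * ?s (?t f) - q * ?s (?t (?s f))) * (b - a)"
      using arg_cong[OF h, of ?s] by (simp only: hom)
    have "isobaric i h * ?V * (a - b) = (isobaric i h * (a - b)) * ?V"
      by (simp only: ac_simps)
    also have "\<dots> = q * (h * ((b - c) * (a - b) * (a - c))) + p * (?s h * ((a - c) * (b - a) * (b - c)))"
      unfolding I by (simp add: algebra_simps)
    also have "\<dots> = q * r * f * (q * (a - c) - p * (b - c)) - p * r * ?s f * (q * (a - c) - p * (b - c))
      + (- q * q * r * ?t f + p * q * q * ?t (?s f) + p * p * r * ?s (?t f) - p * p * q * ?s (?t (?s f))) * (a - b)"
      unfolding h sh by (simp add: algebra_simps)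
    also have "\<dots> = ?sum * (a - b)"
      unfolding key by (simp add: algebra_simps)
    finally show ?thesis
      unfolding h_def g_def abc by (rule xv_cancel[rotated]) simp
  qed
  moreover have "isobaric (Suc i) (isobaric i (isobaric (Suc i) f)) * ?V = ?sum"
  proof -
    define g where "g = isobaric (Suc i) f"
    define h where "h = isobaric i g"
    have g: "g * (b - c) = r * f - q * ?t f"
      unfolding g_def by (rule J)
    have sg: "?s g * (a - c) = r * ?s f - p * ?s (?t f)"
      using arg_cong[OF g, of ?s] by (simp only: hom)
    have "h * ((a - b) * (b - c) * (a - c)) = (h * (a - b)) * (b - c) * (a - c)"
      by (simp only: ac_simps)
    also have "\<dots> = q * (g * (b - c)) * (a - c) - p * (?s g * (a - c)) * (b - c)"
      unfolding h_def I by (simp only: algebra_simps)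
    finally have h: "h * ((a - b) * (b - c) * (a - c))
        = q * (r * f - q * ?t f) * (a - c) - p * (r * ?s f - p * ?s (?t f)) * (b - c)"
      unfolding g sg .
    have th: "?t h * ((a - c) * (c - b) * (a - b))
        = r * (q * ?t f - r * f) * (a - b) - p * (q * ?t (?s f) - p * ?s (?t (?s f))) * (c - b)"
      using arg_cong[OF h, of ?t] by (simp only: hom sw_braid)
    have "isobaric (Suc i) h * ?V * (b - c) = (isobaric (Suc i) h * (b - c)) * ?V"
      by (simp only: ac_simps)
    also have "\<dots> = r * (h * ((a - b) * (b - c) * (a - c))) + q * (?t h * ((a - c) * (c - b) * (a - b)))"
      unfolding J by (simp add: algebra_simps)
    also have "\<dots> = ?sum * (b - c)"
      unfolding h th by (simp add: algebra_simps)
    finally show ?thesis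
      unfolding h_def g_def abc by (rule xv_cancel[rotated]) simp
  qed
  ultimately have "isobaric i (isobaric (Suc i) (isobaric i f)) * ?V
      = isobaric (Suc i) (isobaric i (isobaric (Suc i) f)) * ?V"
    by simp
  then have "isobaric i (isobaric (Suc i) (isobaric i f)) * (a - b) * (a - c)
      = isobaric (Suc i) (isobaric i (isobaric (Suc i) f)) * (a - b) * (a - c)"
    unfolding abc mult.assoc[symmetric] by (rule xv_cancel[rotated]) simp
  then have "isobaric i (isobaric (Suc i) (isobaric i f)) * (a - b)
      = isobaric (Suc i) (isobaric i (isobaric (Suc i) f)) * (a - b)"
    unfolding abc by (rule xv_cancel[rotated]) simp
  then show ?thesis
    unfolding abc by (rule xv_cancel[rotated]) simp
qed


section \<open>Uniqueness of double Grothendieck polynomials\<close>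

abbreviation adj :: "nat \<Rightarrow> nat \<Rightarrow> nat" where
  "adj i \<equiv> transpose i (Suc i)"

definition lin :: "nat \<Rightarrow> nat \<Rightarrow> xy_series" where
  "lin i b = mquot (xv i - yv b) (1 + bet * yv b)"

definition yinv :: "nat \<Rightarrow> xy_series" where
  "yinv b = geo (YVar b) (- [:0, 1:])"

lemma yinv: "(1 + bet * yv b) * yinv b = 1"
  using geo_inverse[of "- [:0, 1:]" "YVar b"] by (simp only: yinv_def mconst_hom) simp

lemma sw_yinv [simp]: "sw i (yinv b) = yinv b"
  by (simp add: yinv_def mswap_geo)

lemma sw_yv [simp]: "sw i (yv b) = yv b"
  by (simp add: mswap_hom)

lemma lin_eq: "lin i b = (xv i - yv b) * yinv b"
  unfolding lin_def by (rule mquot_unit) (rule yinv)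

lemma sw_lin [simp]:
  "sw i (lin i b) = lin (Suc i) b" "sw i (lin (Suc i) b) = lin i b"
  "j \<noteq> i \<Longrightarrow> j \<noteq> Suc i \<Longrightarrow> sw i (lin j b) = lin j b"
  by (simp_all add: lin_eq sw_mult sw_diff)

text \<open>By this an operator deletes one linear factor from a dominant product.\<close>

lemma isobaric_lin: "isobaric i (lin i b) = 1"
proof (rule isobaric_eqI)
  have "om (Suc i) * lin i b - om i * sw i (lin i b)
      = (xv i - xv (Suc i)) * ((1 + bet * yv b) * yinv b)"
    by (simp only: sw_lin) (simp add: lin_eq algebra_simps)
  then show "1 * (xv i - xv (Suc i)) = om (Suc i) * lin i b - om i * sw i (lin i b)"
    by (simp add: yinv)
qed

section \<open>The recursion inside a fixed symmetric group\<close>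

definition staircase_prod :: "nat \<Rightarrow> xy_series" where
  "staircase_prod N = (\<Prod>(i, j)\<in>{(i, j). 1 \<le> i \<and> 1 \<le> j \<and> i + j \<le> N}. lin i j)"

text \<open>Fixing \<open>N\<close> separates two questions: independence of the sequence of
  descents (\<open>reach_unique\<close>) and independence of \<open>N\<close>
  (\<open>reach_Suc\<close>).\<close>

inductive reach :: "nat \<Rightarrow> (nat \<Rightarrow> nat) \<Rightarrow> xy_series \<Rightarrow> bool" for N where
  reach_longest: "reach N (longest_perm N) (staircase_prod N)"
| reach_descent: "reach N w f \<Longrightarrow> 1 \<le> i \<Longrightarrow> w i > w (Suc i) \<Longrightarrow> reach N (w \<circ> adj i) (isobaric i f)"

lemma reach_imp_grothendieck: "reach N w f \<Longrightarrow> is_double_grothendieck w f"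
proof (induction rule: reach.induct)
  case reach_longest
  show ?case
    using is_double_grothendieck.longest[of N] by (simp add: staircase_prod_def lin_def)
next
  case (reach_descent w f i)
  then show ?case
    using is_double_grothendieck.descent[of w f i] by (simp del: comp_apply add: comp_def)
qed

lemma reach_up:
  assumes "reach N (w \<circ> adj i) f" "1 \<le> i" "w i < w (Suc i)"
  shows "reach N w (isobaric i f)"
  using reach_descent[OF assms(1,2)] assms(3) by (simp add: comp_assoc)

lemma longest_perm_permutes: "longest_perm N permutes {1..N}"
proof (rule bij_imp_permutes)
  show "bij_betw (longest_perm N) {1..N} {1..N}"
    by (rule bij_betw_byWitness[of _ "longest_perm N"]) (auto simp: longest_perm_def)
qed (auto simp: longest_perm_def)

lemma permutes_descent_less:
  assumes "w permutes {1..N}" "1 \<le> i" "w i > w (Suc i)"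
  shows "i < N"
proof (rule ccontr)
  assume "\<not> i < N"
  then have "w (Suc i) = Suc i" "w i \<le> i"
    using assms permutes_in_image[OF assms(1), of i] permutes_not_in[OF assms(1)]
    by (auto simp: not_less)
  then show False
    using assms by simp
qed

lemma adj_permutes: "1 \<le> i \<Longrightarrow> i < N \<Longrightarrow> adj i permutes {1..N}"
  by (rule permutes_swap_id) auto

lemma comp_adj_permutes:
  "w permutes {1..N} \<Longrightarrow> 1 \<le> i \<Longrightarrow> i < N \<Longrightarrow> w \<circ> adj i permutes {1..N}"
  by (rule permutes_compose[OF adj_permutes])

lemma reach_permutes: "reach N w f \<Longrightarrow> w permutes {1..N}"
proof (induction rule: reach.induct)
  case (reach_descent w f i)
  then show ?case
    using permutes_descent_less comp_adj_permutes by blast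
qed (rule longest_perm_permutes)

text \<open>For permutations of \<open>{1..N}\<close> this is the length of the longest element
  minus the length of \<open>w\<close>; it serves as induction measure.\<close>

definition noninv :: "nat \<Rightarrow> (nat \<Rightarrow> nat) \<Rightarrow> nat" where
  "noninv N w = card {(a, b). 1 \<le> a \<and> a < b \<and> b \<le> N \<and> w a < w b}"

text \<open>Swapping the positions \<open>i\<close> and \<open>Suc i\<close> injects the
  noninversions of \<open>w \<circ> adj i\<close> into those of \<open>w\<close> and misses the pair
  \<open>(i, Suc i)\<close>.\<close>

lemma noninv_less:
  assumes "1 \<le> i" "i < N" "w i < w (Suc i)"
  shows "noninv N (w \<circ> adj i) < noninv N w"
proof -
  let ?A = "\<lambda>w. {(a, b). 1 \<le> a \<and> a < b \<and> b \<le> N \<and> w a < w b}"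
  let ?f = "map_prod (adj i) (adj i)"
  have fin: "finite (?A w)"
    by (rule finite_subset[of _ "{1..N} \<times> {1..N}"]) auto
  have "?f ` ?A (w \<circ> adj i) \<subseteq> ?A w - {(i, Suc i)}"
  proof clarsimp
    fix a b assume ab: "Suc 0 \<le> a" "a < b" "b \<le> N" "w (adj i a) < w (adj i b)"
    then have "(a, b) \<noteq> (i, Suc i)"
      using assms by auto
    with ab assms show "Suc 0 \<le> adj i a \<and> adj i a < adj i b \<and> adj i b \<le> N \<and> (adj i a = i \<longrightarrow> adj i b \<noteq> Suc i)"
      by (cases "a = i"; cases "b = i"; cases "a = Suc i"; cases "b = Suc i") auto
  qed
  then have "card (?f ` ?A (w \<circ> adj i)) \<le> card (?A w - {(i, Suc i)})"
    using fin by (intro card_mono) auto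
  moreover have "card (?f ` ?A (w \<circ> adj i)) = card (?A (w \<circ> adj i))"
    by (rule card_image, rule inj_on_subset[OF prod.inj_map]) simp_all
  moreover have "card (?A w - {(i, Suc i)}) < card (?A w)"
    using assms by (intro card_Diff1_less fin) auto
  ultimately show ?thesis
    by (simp add: noninv_def)
qed

lemma permutes_neq: "w permutes S \<Longrightarrow> w i \<noteq> w (Suc i)"
  by (metis n_not_Suc_n permutes_inj injD)

text \<open>Along a decreasing \<open>w\<close> the quantity \<open>w i + i\<close> does not
  increase. It is at most \<open>N + 1\<close> at the left end and at least \<open>N + 1\<close> at
  the right end.\<close>

lemma decreasing_imp_longest:
  assumes w: "w permutes {1..N}" and desc: "\<And>i. 1 \<le> i \<Longrightarrow> i < N \<Longrightarrow> w (Suc i) < w i"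
  shows "w = longest_perm N"
proof
  have le: "w i + i \<le> N + 1" if "1 \<le> i" "i \<le> N" for i
    using that
  proof (induction i rule: nat_induct_at_least)
    case base
    then show ?case using permutes_in_image[OF w, of 1] by simp
  next
    case (Suc n)
    then show ?case using desc[of n] by simp
  qed
  have ge: "w i + i \<ge> N + 1" if "1 \<le> i" "i \<le> N" for i
    using that(2,1)
  proof (induction i rule: inc_induct)
    case base
    then show ?case using permutes_in_image[OF w, of N] by simp
  next
    case (step n)
    then show ?case using desc[of n] by simp
  qed
  show "w i = longest_perm N i" for i
    using le[of i] ge[of i] permutes_not_in[OF w, of i]
    by (cases "i \<in> {1..N}") (auto simp: longest_perm_def)
qed

lemma reach_exists:
  assumes "w permutes {1..N}"
  shows "\<exists>f. reach N w f"
  using assms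
proof (induction "noninv N w" arbitrary: w rule: less_induct)
  case less
  show ?case
  proof (cases "\<exists>i. 1 \<le> i \<and> i < N \<and> w i < w (Suc i)")
    case True
    then obtain i where i: "1 \<le> i" "i < N" "w i < w (Suc i)"
      by blast
    then obtain f where "reach N (w \<circ> adj i) f"
      using less.hyps noninv_less comp_adj_permutes less.prems by blast
    then show ?thesis
      using reach_up i by blast
  next
    case False
    then have "w = longest_perm N"
      using permutes_neq[OF less.prems]
      by (intro decreasing_imp_longest[OF less.prems]) (meson linorder_neqE_nat)
    then show ?thesis
      using reach_longest by blast
  qed
qed

text \<open>Diamond argument: two possible last steps are compared through a permutation from which
  both can be continued. Distant steps use commutation, neighbouring ones the braid
  relation.\<close>

lemma reach_unique:
  assumes "reach N w f" "reach N w f'"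
  shows "f = f'"
  using assms
proof (induction "noninv N w" arbitrary: w f f' rule: less_induct)
  case less
  have w: "w permutes {1..N}"
    using less.prems(1) by (rule reach_permutes)
  have cases: "w = longest_perm N \<and> f = staircase_prod N \<or>
      (\<exists>i g. 1 \<le> i \<and> i < N \<and> w i < w (Suc i) \<and> reach N (w \<circ> adj i) g \<and> f = isobaric i g)"
    if "reach N w f" for f
    using that
  proof cases
    case (reach_descent v g i)
    then have "1 \<le> i \<and> i < N \<and> w i < w (Suc i) \<and> reach N (w \<circ> adj i) g \<and> f = isobaric i g"
      using permutes_descent_less[OF reach_permutes[OF \<open>reach N v g\<close>]] by (simp add: comp_assoc)
    then show ?thesis by blast
  qed simp
  have no_ascent: "\<not> (1 \<le> i \<and> i < N \<and> w i < w (Suc i))" if "w = longest_perm N" for i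
    using that by (auto simp: longest_perm_def)
  have diamond: "isobaric i g = isobaric j h"
    if "i \<le> j" and i: "1 \<le> i" "i < N" "w i < w (Suc i)" "reach N (w \<circ> adj i) g"
      and j: "1 \<le> j" "j < N" "w j < w (Suc j)" "reach N (w \<circ> adj j) h" for i j g h
  proof -
    note IHi = less.hyps[OF noninv_less[of i N w, OF i(1-3)] i(4)]
    note IHj = less.hyps[OF noninv_less[of j N w, OF j(1-3)] j(4)]
    consider "i = j" | "j = Suc i" | "Suc i < j"
      using \<open>i \<le> j\<close> by linarith
    then show ?thesis
    proof cases
      case 1
      then show ?thesis using IHi j by simp
    next
      case 2
      \<comment> \<open>The increasing values at \<open>i\<close>, \<open>i + 1\<close>,
        \<open>i + 2\<close> become decreasing here, so two steps lead from \<open>?u\<close> to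
        \<open>w \<circ> adj i\<close> and two others to \<open>w \<circ> adj j\<close>.\<close>
      let ?u = "w \<circ> adj i \<circ> adj j \<circ> adj i"
      have u: "?u = w \<circ> adj j \<circ> adj i \<circ> adj j"
        by (auto simp: 2 fun_eq_iff transpose_def)
      have "?u permutes {1..N}"
        using w i j by (intro comp_adj_permutes)
      then obtain k where k: "reach N ?u k"
        using reach_exists by blast
      have "g = isobaric j (isobaric i k)"
        using i j by (intro IHi reach_up k) (auto simp: 2 transpose_def)
      moreover have "h = isobaric i (isobaric j k)"
        using i j by (intro IHj reach_up k[unfolded u]) (auto simp: 2 transpose_def)
      ultimately show ?thesis
        by (simp add: 2 isobaric_braid)
    next
      case 3
      let ?u = "w \<circ> adj i \<circ> adj j"
      have u: "?u = w \<circ> adj j \<circ> adj i"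
        using 3 by (auto simp: fun_eq_iff transpose_def)
      have "?u permutes {1..N}"
        using w i j by (intro comp_adj_permutes)
      then obtain k where k: "reach N ?u k"
        using reach_exists by blast
      have "g = isobaric j k"
        using i j 3 by (intro IHi reach_up k) (auto simp: transpose_def)
      moreover have "h = isobaric i k"
        using i j 3 by (intro IHj reach_up k[unfolded u]) (auto simp: transpose_def)
      ultimately show ?thesis
        using isobaric_commute[OF 3] by simp
    qed
  qed
  show ?case
    using cases[OF less.prems(1)] cases[OF less.prems(2)] no_ascent
  proof (elim disjE exE conjE)
    fix i g j h
    assume "1 \<le> i" "i < N" "w i < w (Suc i)" "reach N (w \<circ> adj i) g" "f = isobaric i g"
      and "1 \<le> j" "j < N" "w j < w (Suc j)" "reach N (w \<circ> adj j) h" "f' = isobaric j h"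
    then show ?thesis
      using diamond[of i j g h] diamond[of j i h g] by (cases "i \<le> j") auto
  qed auto
qed

section \<open>Lehmer codes, dominant permutations and independence of \<open>N\<close>\<close>

definition code :: "nat \<Rightarrow> (nat \<Rightarrow> nat) \<Rightarrow> nat \<Rightarrow> nat" where
  "code N w i = card {b. i < b \<and> b \<le> N \<and> w b < w i}"

definition dominant_prod :: "nat \<Rightarrow> (nat \<Rightarrow> nat) \<Rightarrow> xy_series" where
  "dominant_prod N w = (\<Prod>i\<in>{1..N}. \<Prod>b\<in>{1..code N w i}. lin i b)"

lemma finite_code_set: "finite {b. i < b \<and> b \<le> (N::nat) \<and> P b}"
  by (rule finite_subset[of _ "{..N}"]) auto

lemma code_less_Suc:
  assumes "i < N" "w (Suc i) < w i"
  shows "code N w (Suc i) < code N w i"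
  unfolding code_def
proof (rule psubset_card_mono[OF finite_code_set])
  let ?B = "\<lambda>i. {b. i < b \<and> b \<le> N \<and> w b < w i}"
  have "?B (Suc i) \<subseteq> ?B i" "Suc i \<in> ?B i" "Suc i \<notin> ?B (Suc i)"
    using assms by auto
  then show "?B (Suc i) \<subset> ?B i"
    by blast
qed

lemma code_le_Suc:
  assumes "i < N" "w i < w (Suc i)"
  shows "code N w i \<le> code N w (Suc i)"
  unfolding code_def
proof (rule card_mono[OF finite_code_set], clarify)
  fix b assume "i < b" "b \<le> N" "w b < w i"
  then show "Suc i < b \<and> b \<le> N \<and> w b < w (Suc i)"
    using assms by (cases "b = Suc i") auto
qed

lemma code_adj:
  assumes "i < N" "w i < w (Suc i)"
  shows "code N (w \<circ> adj i) i = Suc (code N w (Suc i))" "code N (w \<circ> adj i) (Suc i) = code N w i"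
    "j \<noteq> i \<Longrightarrow> j \<noteq> Suc i \<Longrightarrow> code N (w \<circ> adj i) j = code N w j"
proof -
  have "{b. i < b \<and> b \<le> N \<and> (w \<circ> adj i) b < (w \<circ> adj i) i}
      = insert (Suc i) {b. Suc i < b \<and> b \<le> N \<and> w b < w (Suc i)}" (is "?A = insert _ ?B")
  proof (rule Set.set_eqI)
    show "b \<in> ?A \<longleftrightarrow> b \<in> insert (Suc i) ?B" for b
      using assms by (cases "b = Suc i") (auto simp: transpose_def)
  qed
  then show "code N (w \<circ> adj i) i = Suc (code N w (Suc i))"
    using finite_code_set[of "Suc i" N] by (simp add: code_def del: comp_apply)
  have "{b. Suc i < b \<and> b \<le> N \<and> (w \<circ> adj i) b < (w \<circ> adj i) (Suc i)}
      = {b. i < b \<and> b \<le> N \<and> w b < w i}" (is "?A = ?B")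
  proof (rule Set.set_eqI)
    show "b \<in> ?A \<longleftrightarrow> b \<in> ?B" for b
      using assms by (cases "b = Suc i") (auto simp: transpose_def)
  qed
  then show "code N (w \<circ> adj i) (Suc i) = code N w i"
    by (simp add: code_def del: comp_apply)
  assume j: "j \<noteq> i" "j \<noteq> Suc i"
  have "adj i ` {b. j < b \<and> b \<le> N \<and> (w \<circ> adj i) b < (w \<circ> adj i) j}
      = {b. j < b \<and> b \<le> N \<and> w b < w j}" (is "_ ` ?A = ?B")
  proof (rule Set.set_eqI)
    fix b
    have "b \<in> adj i ` ?A \<longleftrightarrow> adj i b \<in> ?A"
      by (metis (no_types, lifting) image_iff transpose_involutory)
    also have "\<dots> \<longleftrightarrow> b \<in> ?B"
      using assms j by (auto simp: transpose_def split: if_splits)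
    finally show "b \<in> adj i ` ?A \<longleftrightarrow> b \<in> ?B" .
  qed
  moreover have "card (adj i ` ?A) = card ?A"
    by (rule card_image, rule inj_on_transpose)
  ultimately show "code N (w \<circ> adj i) j = code N w j"
    by (simp add: code_def del: comp_apply)
qed

lemma code_longest_perm: "i \<le> M \<Longrightarrow> M \<le> N \<Longrightarrow> 1 \<le> i \<Longrightarrow> code N (longest_perm M) i = M - i"
proof -
  assume "i \<le> M" "M \<le> N" "1 \<le> i"
  then have "{b. i < b \<and> b \<le> N \<and> longest_perm M b < longest_perm M i} = {i<..M}"
    by (auto simp: longest_perm_def)
  then show ?thesis
    by (simp add: code_def)
qed

lemma staircase_prod_eq: "staircase_prod M = (\<Prod>i\<in>{1..M}. \<Prod>b\<in>{1..M - i}. lin i b)"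
proof -
  have "{(i, j). 1 \<le> i \<and> 1 \<le> j \<and> i + j \<le> M} = Sigma {1..M} (\<lambda>i. {1..M - i})"
    by auto
  then show ?thesis
    by (simp add: staircase_prod_def prod.Sigma)
qed

text \<open>If all code inequalities are strict, \<open>w\<close> is the longest element. At an
  equality \<open>w\<close> has an ascent, and \<open>w \<circ> adj i\<close> has one more linear
  factor, which \<open>isobaric_lin\<close> removes.\<close>

lemma reach_dominant:
  assumes "w permutes {1..N}" "\<And>i. 1 \<le> i \<Longrightarrow> i < N \<Longrightarrow> code N w (Suc i) \<le> code N w i"
  shows "reach N w (dominant_prod N w)"
  using assms
proof (induction "noninv N w" arbitrary: w rule: less_induct)
  case less
  note w = less.prems(1)
  let ?P = "\<lambda>i. 1 \<le> i \<and> i < N \<and> code N w (Suc i) = code N w i"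
  show ?case
  proof (cases "\<exists>i. ?P i")
    case True
    \<comment> \<open>At the first equality the preceding code entry is strictly larger, so the code
      stays weakly decreasing when entry \<open>i\<close> grows by one.\<close>
    define i where "i = (LEAST i. ?P i)"
    have "?P i"
      unfolding i_def using True by (rule LeastI_ex)
    then have i: "1 \<le> i" "i < N" "code N w (Suc i) = code N w i"
      by auto
    have min: "code N w (Suc j) < code N w j" if "1 \<le> j" "j < i" for j
      using not_less_Least[of j ?P] that i less.prems(2)[of j] by (fastforce simp: i_def)
    have asc: "w i < w (Suc i)"
      using code_less_Suc[of i N w] i permutes_neq[OF w, of i] by linarith
    let ?v = "w \<circ> adj i"
    note code = code_adj[OF i(2) asc]
    have dom: "code N ?v (Suc j) \<le> code N ?v j" if j: "1 \<le> j" "j < N" for j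
    proof -
      consider "j = i" | "j = Suc i" | "Suc j = i" | "j \<noteq> i" "j \<noteq> Suc i" "Suc j \<noteq> i"
        by blast
      then show ?thesis
      proof cases
        case 2
        then show ?thesis using code(2,3) i less.prems(2)[of j] j by simp
      next
        case 3
        then show ?thesis using code(1) code(3)[of j] i min[of j] j by auto
      qed (use code i less.prems(2)[of j] j in auto)
    qed
    have "reach N w (isobaric i (dominant_prod N ?v))"
      by (intro reach_up less.hyps noninv_less comp_adj_permutes w asc i dom)
    moreover have "isobaric i (dominant_prod N ?v) = dominant_prod N w"
    proof -
      have split: "{1..N} = insert i (insert (Suc i) ({1..N} - {i, Suc i}))"
        using i by auto
      let ?R = "\<Prod>j\<in>{1..N} - {i, Suc i}. \<Prod>b\<in>{1..code N w j}. lin j b"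
      let ?c = "code N w i"
      have w_eq: "dominant_prod N w = (\<Prod>b\<in>{1..?c}. lin i b) * ((\<Prod>b\<in>{1..?c}. lin (Suc i) b) * ?R)"
        unfolding dominant_prod_def by (subst split) (simp add: i)
      have "dominant_prod N ?v = (\<Prod>b\<in>{1..Suc ?c}. lin i b) * ((\<Prod>b\<in>{1..?c}. lin (Suc i) b) *
          (\<Prod>j\<in>{1..N} - {i, Suc i}. \<Prod>b\<in>{1..code N ?v j}. lin j b))"
        unfolding dominant_prod_def by (subst split) (simp add: code i del: comp_apply prod.cl_ivl_Suc)
      also have "(\<Prod>j\<in>{1..N} - {i, Suc i}. \<Prod>b\<in>{1..code N ?v j}. lin j b) = ?R"
        by (rule prod.cong) (auto simp: code(3) simp del: comp_apply)
      also have "(\<Prod>b\<in>{1..Suc ?c}. lin i b) * ((\<Prod>b\<in>{1..?c}. lin (Suc i) b) * ?R)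
          = dominant_prod N w * lin i (Suc ?c)"
        unfolding w_eq by (simp add: ac_simps)
      finally have v_eq: "dominant_prod N ?v = dominant_prod N w * lin i (Suc ?c)" .
      have "sw i (dominant_prod N w) = dominant_prod N w"
        unfolding w_eq by (simp add: sw_mult mswap_prod ac_simps)
      then show ?thesis
        unfolding v_eq by (simp add: isobaric_mult_left isobaric_lin)
    qed
    ultimately show ?thesis by simp
  next
    case False
    have "w = longest_perm N"
    proof (rule decreasing_imp_longest[OF w])
      fix i assume i: "1 \<le> i" "i < N"
      then have "code N w (Suc i) < code N w i"
        using False less.prems(2)[of i] by (meson le_neq_implies_less)
      then have "\<not> w i < w (Suc i)"
        using code_le_Suc[of i N w] i by auto
      then show "w (Suc i) < w i"
        using permutes_neq[OF w, of i] by linarith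
    qed
    moreover have "dominant_prod N (longest_perm N) = staircase_prod N"
      unfolding dominant_prod_def staircase_prod_eq
      by (intro prod.cong) (auto simp: code_longest_perm)
    ultimately show ?thesis
      using reach_longest by simp
  qed
qed

text \<open>The longest element for \<open>N\<close> is dominant for \<open>Suc N\<close>, with the
  same staircase product; all later steps are shared.\<close>

lemma reach_Suc:
  assumes "reach N w f"
  shows "reach (Suc N) w f"
  using assms
proof (induction rule: reach.induct)
  case reach_longest
  let ?w = "longest_perm N"
  have top: "code (Suc N) ?w (Suc N) = 0"
    by (simp add: code_def)
  have "reach (Suc N) ?w (dominant_prod (Suc N) ?w)"
  proof (rule reach_dominant)
    show "?w permutes {1..Suc N}"
      using longest_perm_permutes by (rule permutes_subset) auto
    show "code (Suc N) ?w (Suc i) \<le> code (Suc N) ?w i" if "1 \<le> i" "i < Suc N" for i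
      using that top code_longest_perm[of "Suc i" N "Suc N"] code_longest_perm[of i N "Suc N"]
      by (cases "i = N") auto
  qed
  moreover have "dominant_prod (Suc N) ?w = staircase_prod N"
    unfolding dominant_prod_def staircase_prod_eq by (simp add: top code_longest_perm)
  ultimately show ?case by simp
next
  case (reach_descent w f i)
  then show ?case using reach.reach_descent by blast
qed

lemma grothendieck_imp_reach: "is_double_grothendieck w f \<Longrightarrow> \<exists>N. reach N w f"
proof (induction rule: is_double_grothendieck.induct)
  case (longest n)
  then show ?case
    using reach_longest[of n] by (auto simp: staircase_prod_def lin_def)
next
  case (descent w f i)
  then obtain N where "reach N w f" by blast
  with descent have "reach N (w \<circ> adj i) (isobaric i f)"
    by (intro reach_descent) simp_all
  then show ?case by (auto simp: comp_def)
qed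

lemma is_double_grothendieck_unique:
  assumes "is_double_grothendieck w f" "is_double_grothendieck w f'"
  shows "f = f'"
proof -
  have up: "reach (M + k) w f" if "reach M w f" for M k f
    by (induction k) (use that reach_Suc in auto)
  obtain M N where "reach M w f" "reach N w f'"
    using assms grothendieck_imp_reach by blast
  then have "reach (M + N) w f" "reach (M + N) w f'"
    using up[of M f N] up[of N f' M] by (simp_all add: add.commute)
  then show ?thesis
    by (rule reach_unique)
qed

lemma double_grothendieck_eqI:
  "is_double_grothendieck w f \<Longrightarrow> double_grothendieck w = f"
  unfolding double_grothendieck_def by (rule the_equality) (auto intro: is_double_grothendieck_unique)


section \<open>Divided differences of functions of one variable\<close>

definition oinv :: "nat \<Rightarrow> xy_series" where
  "oinv i = geo (XVar i) (- [:0, 1:])"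

lemma om_oinv: "om i * oinv i = 1"
  using geo_inverse[of "- [:0, 1:]" "XVar i"] by (simp only: oinv_def mconst_hom) simp

lemma sw_oinv [simp]:
  "sw i (oinv i) = oinv (Suc i)" "sw i (oinv (Suc i)) = oinv i"
  "j \<noteq> i \<Longrightarrow> j \<noteq> Suc i \<Longrightarrow> sw i (oinv j) = oinv j"
  by (simp_all add: oinv_def mswap_geo)

lemma oinv_om_cancel: "oinv i * (om i * f) = f"
  by (simp only: mult.assoc[symmetric] mult.commute[of "oinv i"] om_oinv mult_1)

lemma om_cancel: "om i * f = om i * g \<Longrightarrow> f = g"
  using oinv_om_cancel[of i f] oinv_om_cancel[of i g] by argo

text \<open>Since \<open>om i\<close> is a unit, the eigenvectors for \<open>-\<beta>\<close> are
  exactly the symmetric series. This lets symmetry be read off from the braid relation.\<close>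

lemma isobaric_of_sym_conv:
  assumes "isobaric i f = - bet * f"
  shows "sw i f = f"
proof -
  have "- bet * f * (xv i - xv (Suc i)) = om (Suc i) * f - om i * sw i f"
    unfolding assms[symmetric] by (rule isobaric_mult_diff)
  then have "om i * sw i f = om i * f"
    by (simp add: algebra_simps)
  then show ?thesis
    by (rule om_cancel)
qed

text \<open>Symmetry in \<open>x_2, x_3, ...\<close> stands in for containing no \<open>x\<close>
  variable other than \<open>x_1\<close>; it is the form in which the operators can use that
  property.\<close>

definition only_first :: "xy_series \<Rightarrow> bool" where
  "only_first g \<longleftrightarrow> (\<forall>j\<ge>2. sw j g = g)"

lemma only_first_mult: "only_first f \<Longrightarrow> only_first g \<Longrightarrow> only_first (f * g)"
  by (simp add: only_first_def sw_mult)

lemma only_first_1: "only_first 1"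
  by (simp add: only_first_def mswap_hom)

lemma only_first_power: "only_first f \<Longrightarrow> only_first (f ^ k)"
  by (induction k) (simp_all add: only_first_1 only_first_mult)

lemma only_first_prod: "(\<And>a. a \<in> A \<Longrightarrow> only_first (f a)) \<Longrightarrow> only_first (prod f A)"
  by (induction A rule: infinite_finite_induct) (simp_all add: only_first_1 only_first_mult)

lemma only_first_basic: "only_first (om (Suc 0))" "only_first (oinv (Suc 0))" "only_first (lin (Suc 0) b)"
  unfolding only_first_def by (auto intro!: sw_om sw_oinv sw_lin)

lemmas only_first_intros = only_first_mult only_first_power only_first_prod only_first_1 only_first_basic

text \<open>On an \<open>only_first\<close> series, the composite of the operators
  \<open>1, ..., k\<close> gives a series symmetric in \<open>x_1, ..., x_{k+1}\<close> and,
  separately, in the later \<open>x\<close> variables.\<close>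

primrec iso_chain :: "nat \<Rightarrow> xy_series \<Rightarrow> xy_series" where
  "iso_chain 0 g = g"
| "iso_chain (Suc k) g = isobaric (Suc k) (iso_chain k g)"

lemma sw_iso_chain_far:
  assumes "only_first g" "k + 2 \<le> j"
  shows "sw j (iso_chain k g) = iso_chain k g"
  using assms(2)
proof (induction k)
  case 0
  then show ?case using assms(1) by (simp add: only_first_def)
next
  case (Suc k)
  then show ?case by (simp add: sw_isobaric_far)
qed

text \<open>By the braid relation, the chain is an eigenvector of \<open>\<pi>\<^sub>i\<close> for eigenvalue \<open>-\<beta>\<close>.\<close>

lemma sw_iso_chain_near:
  assumes g: "only_first g" and "1 \<le> i" "i \<le> k"
  shows "sw i (iso_chain k g) = iso_chain k g"
  using assms(3)
proof (induction k)
  case 0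
  then show ?case using assms(2) by simp
next
  case (Suc k)
  consider "i = Suc k" | "i = k" | "i < k"
    using Suc.prems by linarith
  then show ?case
  proof cases
    case 2
    then obtain k' where k: "k = Suc k'"
      using assms(2) by (cases k) auto
    let ?X = "iso_chain k' g"
    have "isobaric (Suc k) ?X = - bet * ?X"
      by (rule isobaric_of_sym, rule sw_iso_chain_far[OF g]) (simp add: k)
    then have "isobaric k (isobaric (Suc k) (isobaric k ?X)) = isobaric (Suc k) (isobaric k (- bet * ?X))"
      by (simp add: isobaric_braid)
    also have "\<dots> = - bet * isobaric (Suc k) (isobaric k ?X)"
      by (subst isobaric_mult_left, simp add: mswap_hom)+ simp
    finally have "isobaric k (iso_chain (Suc k) g) = - bet * iso_chain (Suc k) g"
      by (simp add: k)
    then show ?thesis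
      unfolding 2 by (rule isobaric_of_sym_conv)
  next
    case 3
    then show ?thesis using Suc.IH by (simp add: sw_isobaric_far)
  qed simp
qed

text \<open>In the variables \<open>\<xi> = x / (1 + \<beta>x)\<close> the operator \<open>tau\<close> is an ordinary divided difference.\<close>

definition tau :: "nat \<Rightarrow> xy_series \<Rightarrow> xy_series" where
  "tau i f = isobaric i (om i * f)"

lemma tau_mult_diff: "tau i f * (xv i - xv (Suc i)) = om i * om (Suc i) * (f - sw i f)"
  unfolding tau_def isobaric_mult_diff sw_mult sw_om by (simp add: algebra_simps)

lemma tau_eqI:
  assumes "h * (xv i - xv (Suc i)) = om i * om (Suc i) * (f - sw i f)"
  shows "tau i f = h"
proof (rule xv_cancel)
  show "tau i f * (xv i - xv (Suc i)) = h * (xv i - xv (Suc i))"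
    by (simp only: assms tau_mult_diff)
qed simp

lemma tau_sym: "sw i f = f \<Longrightarrow> tau i f = 0"
  by (rule tau_eqI) simp

lemma tau_add: "tau i (f + g) = tau i f + tau i g"
  by (simp add: tau_def distrib_left isobaric_add)

lemma isobaric_om_mult: "isobaric i (om i * f) = om (Suc i) * isobaric i f + bet * om (Suc i) * f"
proof (rule isobaric_eqI)
  have "(om (Suc i) * isobaric i f + bet * om (Suc i) * f) * (xv i - xv (Suc i))
      = om (Suc i) * (isobaric i f * (xv i - xv (Suc i))) + bet * om (Suc i) * f * (xv i - xv (Suc i))"
    by (simp add: algebra_simps)
  also have "\<dots> = om (Suc i) * (om i * f) - om i * (om (Suc i) * sw i f)"
    unfolding isobaric_mult_diff by (simp add: algebra_simps)
  finally show "(om (Suc i) * isobaric i f + bet * om (Suc i) * f) * (xv i - xv (Suc i))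
      = om (Suc i) * (om i * f) - om i * sw i (om i * f)"
    by (simp only: sw_mult sw_om)
qed

text \<open>Pushing \<open>om\<close> through the chain by \<open>isobaric_om_mult\<close> leaves
  the correction term \<open>bet * ?U\<close>, which is symmetric in the next two variables and
  hence killed by \<open>tau\<close>.\<close>

lemma iso_chain_om:
  assumes h: "only_first h"
  shows "iso_chain (Suc k) (om (Suc 0) * h) = tau (Suc k) (iso_chain k h)"
proof (induction k)
  case 0
  then show ?case by (simp add: tau_def)
next
  case (Suc k)
  let ?U = "iso_chain k h" and ?i = "Suc (Suc k)"
  have sym: "sw ?i (bet * ?U) = bet * ?U"
    using sw_iso_chain_far[OF h, of k ?i] by (simp add: mswap_hom)
  have "iso_chain ?i (om (Suc 0) * h) = isobaric ?i (tau (Suc k) ?U)"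
    using Suc.IH by simp
  also have "\<dots> = isobaric ?i (om ?i * isobaric (Suc k) ?U + om ?i * (bet * ?U))"
    unfolding tau_def isobaric_om_mult by (simp only: ac_simps)
  also have "\<dots> = tau ?i (iso_chain (Suc k) h) + tau ?i (bet * ?U)"
    unfolding isobaric_add tau_def by simp
  finally show ?case
    using tau_sym[OF sym] by simp
qed

text \<open>The divided difference on the \<open>k\<close> nodes \<open>xi 1, ..., xi k\<close>, of
  order \<open>k - 1\<close>. The value 0 for no nodes makes the Leibniz rule hold from the first
  node on.\<close>

primrec divdiff :: "nat \<Rightarrow> xy_series \<Rightarrow> xy_series" where
  "divdiff 0 g = 0"
| "divdiff (Suc k) g = (if k = 0 then g else tau k (divdiff k g))"

lemma divdiff_eq_iso_chain:
  assumes "only_first g"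
  shows "divdiff (Suc k) g = iso_chain k (om (Suc 0) ^ k * g)"
  using assms
proof (induction k)
  case (Suc k)
  have "only_first (om (Suc 0) ^ k * g)"
    using Suc.prems by (intro only_first_intros)
  then show ?case
    using Suc iso_chain_om[of "om (Suc 0) ^ k * g" k] by (simp add: mult.assoc)
qed simp

lemma sw_divdiff:
  assumes "only_first g"
  shows "sw (Suc k) (divdiff k g) = divdiff k g"
proof (cases k)
  case 0
  then show ?thesis by (simp add: mswap_hom)
next
  case (Suc k')
  have "only_first (om (Suc 0) ^ k' * g)"
    using assms by (intro only_first_intros)
  then show ?thesis
    using sw_iso_chain_far[of _ k' "Suc k"] Suc divdiff_eq_iso_chain[OF assms, of k'] by simp
qed

section \<open>The Leibniz rule in the variables \<open>xi\<close>\<close>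

definition xi :: "nat \<Rightarrow> xy_series" where
  "xi i = xv i * oinv i"

lemma sw_xi: "sw i (xi i) = xi (Suc i)"
  by (simp add: xi_def sw_mult)

text \<open>With \<open>tau_mult_diff\<close> this identifies \<open>tau i f\<close> as
  \<open>(f - sw i f) / (xi i - xi (Suc i))\<close>.\<close>

lemma om_om_xi_diff: "om i * om j * (xi i - xi j) = xv i - xv j"
proof -
  have "om i * om j * (xi i - xi j) = xv i * om j * (om i * oinv i) - xv j * om i * (om j * oinv j)"
    unfolding xi_def by (simp only: algebra_simps)
  also have "\<dots> = xv i - xv j"
    unfolding om_oinv by (simp add: algebra_simps)
  finally show ?thesis .
qed

lemma tau_linear_mult:
  assumes "sw i a = a" "sw i b = b"
  shows "tau i ((a + b * xi i) * f) = (a + b * xi (Suc i)) * tau i f + b * f"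
proof (rule tau_eqI)
  let ?d = "xv i - xv (Suc i)" and ?o = "om i * om (Suc i)"
  have "((a + b * xi (Suc i)) * tau i f + b * f) * ?d
      = (a + b * xi (Suc i)) * (tau i f * ?d) + b * f * ?d"
    by (simp only: algebra_simps)
  also have "\<dots> = (a + b * xi (Suc i)) * (?o * (f - sw i f)) + b * f * (?o * (xi i - xi (Suc i)))"
    unfolding tau_mult_diff om_om_xi_diff ..
  also have "\<dots> = ?o * ((a + b * xi i) * f - (a + b * xi (Suc i)) * sw i f)"
    by (simp only: algebra_simps)
  also have "(a + b * xi (Suc i)) * sw i f = sw i ((a + b * xi i) * f)"
    by (simp add: sw_mult sw_add assms sw_xi)
  finally show "((a + b * xi (Suc i)) * tau i f + b * f) * ?d = ?o * ((a + b * xi i) * f - sw i ((a + b * xi i) * f))" .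
qed

text \<open>In the Leibniz rule only two terms survive, because an affine function of
  \<open>xi\<close> has slope \<open>b\<close> and no higher divided differences.\<close>

lemma divdiff_linear_mult:
  assumes g: "only_first g" and ab: "\<And>i. sw i a = a" "\<And>i. sw i b = b"
  shows "divdiff (Suc k) ((a + b * xi (Suc 0)) * g)
    = (a + b * xi (Suc k)) * divdiff (Suc k) g + b * divdiff k g"
proof (induction k)
  case (Suc k)
  have "sw (Suc k) (b * divdiff k g) = b * divdiff k g"
    by (simp add: sw_mult sw_divdiff g ab)
  then have "tau (Suc k) (b * divdiff k g) = 0"
    by (rule tau_sym)
  then have "divdiff (Suc (Suc k)) ((a + b * xi (Suc 0)) * g)
      = tau (Suc k) ((a + b * xi (Suc k)) * divdiff (Suc k) g)"
    using Suc by (simp only: divdiff.simps(2)[of "Suc k"] nat.distinct if_False tau_add add_0_right)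
  also have "\<dots> = (a + b * xi (Suc (Suc k))) * divdiff (Suc (Suc k)) g + b * divdiff (Suc k) g"
    by (simp only: tau_linear_mult ab divdiff.simps(2)[of "Suc k"] nat.distinct if_False)
  finally show ?case .
qed simp

section \<open>Determinants of divided differences\<close>

definition ddet :: "nat \<Rightarrow> (nat \<Rightarrow> xy_series) \<Rightarrow> xy_series" where
  "ddet r g = det (mat r r (\<lambda>(i, j). divdiff (r - j) (g i)))"

text \<open>Quantifying over all \<open>r\<close> and all rows \<open>g\<close> makes the property
  closed under products and inverses.\<close>

definition extractable :: "(nat \<Rightarrow> xy_series) \<Rightarrow> bool" where
  "extractable \<phi> \<longleftrightarrow> only_first (\<phi> (Suc 0)) \<and>
     (\<forall>r g. (\<forall>i<r. only_first (g i)) \<longrightarrow>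
        ddet r (\<lambda>i. \<phi> (Suc 0) * g i) = (\<Prod>c\<in>{1..r}. \<phi> c) * ddet r g)"

lemma extractableD:
  assumes "extractable \<phi>" "\<forall>i<r. only_first (g i)"
  shows "ddet r (\<lambda>i. \<phi> (Suc 0) * g i) = (\<Prod>c\<in>{1..r}. \<phi> c) * ddet r g"
  using assms(1)[unfolded extractable_def, THEN conjunct2, rule_format, of r g] assms(2) by simp

text \<open>By the two-term Leibniz rule an affine factor acts on the columns through the lower
  bidiagonal matrix \<open>?B\<close>, whose diagonal is
  \<open>\<phi> r, ..., \<phi> 1\<close>.\<close>

lemma extractable_linear:
  assumes ab: "\<And>i. sw i a = a" "\<And>i. sw i b = b"
  shows "extractable (\<lambda>c. a + b * xi c)"
  unfolding extractable_def
proof (intro conjI allI impI)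
  show "only_first (a + b * xi (Suc 0))"
    by (auto simp: only_first_def sw_add sw_mult ab xi_def)
  fix r :: nat and g :: "nat \<Rightarrow> xy_series" assume g: "\<forall>i<r. only_first (g i)"
  let ?\<phi> = "\<lambda>c. a + b * xi c"
  let ?A = "mat r r (\<lambda>(i, j). divdiff (r - j) (g i))"
  let ?B = "mat r r (\<lambda>(l, j). if l = j then ?\<phi> (r - j) else if l = Suc j then b else 0)"
  have "mat r r (\<lambda>(i, j). divdiff (r - j) (?\<phi> (Suc 0) * g i)) = ?A * ?B" (is "?L = _")
  proof (rule eq_matI)
    fix i j assume "i < dim_row (?A * ?B)" "j < dim_col (?A * ?B)"
    then have ij: "i < r" "j < r" by auto
    have "(?A * ?B) $$ (i, j) = (\<Sum>l<r. divdiff (r - l) (g i) *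
        (if l = j then ?\<phi> (r - j) else if l = Suc j then b else 0))"
      using ij by (simp add: scalar_prod_def lessThan_atLeast0)
    also have "\<dots> = (\<Sum>l<r. (if l = j then divdiff (r - j) (g i) * ?\<phi> (r - j) else 0)
        + (if l = Suc j then divdiff (r - Suc j) (g i) * b else 0))"
      by (rule sum.cong) auto
    \<comment> \<open>In the last column no row \<open>Suc j\<close> exists, which agrees with
      \<open>divdiff 0\<close> being 0.\<close>
    also have "\<dots> = divdiff (r - j) (g i) * ?\<phi> (r - j) + divdiff (r - Suc j) (g i) * b"
      using ij by (cases "Suc j = r") (auto simp: sum.distrib)
    also have "\<dots> = divdiff (Suc (r - Suc j)) (?\<phi> (Suc 0) * g i)"
      using g ij Suc_diff_Suc[of j r] by (subst divdiff_linear_mult) (auto simp: ab algebra_simps)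
    finally show "?L $$ (i, j) = (?A * ?B) $$ (i, j)"
      using ij by (simp add: Suc_diff_Suc)
  qed auto
  moreover have "det ?B = (\<Prod>c\<in>{1..r}. ?\<phi> c)"
  proof -
    have "det ?B = prod_list (diag_mat ?B)"
      by (rule det_lower_triangular[of r]) auto
    also have "\<dots> = (\<Prod>j\<in>{0..<r}. ?\<phi> (r - j))"
      by (simp add: prod_list_diag_prod)
    also have "\<dots> = (\<Prod>c\<in>{1..r}. ?\<phi> c)"
      by (rule prod.reindex_bij_witness[of _ "\<lambda>c. r - c" "\<lambda>j. r - j"]) auto
    finally show ?thesis .
  qed
  ultimately show "ddet r (\<lambda>i. ?\<phi> (Suc 0) * g i) = (\<Prod>c\<in>{1..r}. ?\<phi> c) * ddet r g"
    unfolding ddet_def using det_mult[of ?A r ?B] by (simp add: mult.commute)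
qed

lemma extractable_mult:
  assumes "extractable \<phi>" "extractable \<psi>"
  shows "extractable (\<lambda>c. \<phi> c * \<psi> c)"
  unfolding extractable_def
proof (intro conjI allI impI)
  show "only_first (\<phi> (Suc 0) * \<psi> (Suc 0))"
    using assms by (simp add: extractable_def only_first_mult)
  fix r :: nat and g :: "nat \<Rightarrow> xy_series" assume g: "\<forall>i<r. only_first (g i)"
  then have "\<forall>i<r. only_first (\<psi> (Suc 0) * g i)"
    using assms by (simp add: extractable_def only_first_mult)
  then show "ddet r (\<lambda>i. \<phi> (Suc 0) * \<psi> (Suc 0) * g i) = (\<Prod>c\<in>{1..r}. \<phi> c * \<psi> c) * ddet r g"
    using assms g by (simp add: extractable_def prod.distrib mult.assoc)
qed

lemma extractable_prod:
  assumes "\<And>a. a \<in> A \<Longrightarrow> extractable (\<phi> a)"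
  shows "extractable (\<lambda>c. \<Prod>a\<in>A. \<phi> a c)"
proof -
  have "extractable (\<lambda>c. 1)"
    by (simp add: extractable_def only_first_1)
  then show ?thesis
    using assms by (induction A rule: infinite_finite_induct) (simp_all add: extractable_mult)
qed

lemma extractable_inverse:
  assumes "extractable \<phi>" and inv: "\<And>c. \<phi> c * \<psi> c = 1" and first: "only_first (\<psi> (Suc 0))"
  shows "extractable \<psi>"
  unfolding extractable_def
proof (intro conjI allI impI)
  fix r :: nat and g :: "nat \<Rightarrow> xy_series" assume g: "\<forall>i<r. only_first (g i)"
  then have "\<forall>i<r. only_first (\<psi> (Suc 0) * g i)"
    by (simp add: only_first_mult first)
  then have "ddet r (\<lambda>i. \<phi> (Suc 0) * (\<psi> (Suc 0) * g i)) = (\<Prod>c\<in>{1..r}. \<phi> c) * ddet r (\<lambda>i. \<psi> (Suc 0) * g i)"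
    by (rule extractableD[OF assms(1)])
  moreover have "\<phi> (Suc 0) * (\<psi> (Suc 0) * g i) = g i" for i
    by (simp only: mult.assoc[symmetric] inv mult_1)
  ultimately have g_eq: "ddet r g = (\<Prod>c\<in>{1..r}. \<phi> c) * ddet r (\<lambda>i. \<psi> (Suc 0) * g i)"
    by (simp only:)
  have "(\<Prod>c\<in>{1..r}. \<psi> c) * (\<Prod>c\<in>{1..r}. \<phi> c) = 1"
    by (subst mult.commute) (simp only: prod.distrib[symmetric] inv prod.neutral_const)
  then show "ddet r (\<lambda>i. \<psi> (Suc 0) * g i) = (\<Prod>c\<in>{1..r}. \<psi> c) * ddet r g"
    unfolding g_eq by (simp only: mult.assoc[symmetric] mult_1)
qed (rule first)

lemma oinv_eq: "oinv c = 1 + (- bet) * xi c"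
  using om_oinv[of c] by (simp add: xi_def algebra_simps)

lemma lin_eq_xi: "lin c b = om c * (- (yv b * yinv b) + 1 * xi c)"
proof -
  have "om c * (- (yv b * yinv b) + 1 * xi c) = xv c * (om c * oinv c) - om c * (yv b * yinv b)"
    by (simp add: xi_def algebra_simps)
  also have "\<dots> = xv c * ((1 + bet * yv b) * yinv b) - om c * (yv b * yinv b)"
    unfolding om_oinv yinv ..
  also have "\<dots> = lin c b"
    by (simp add: lin_eq algebra_simps)
  finally show ?thesis ..
qed

text \<open>\<open>oinv\<close> is affine in \<open>xi\<close>, so its inverse \<open>om\<close> is
  extractable; \<open>lin\<close> is \<open>om\<close> times an affine function of
  \<open>xi\<close>.\<close>

lemma extractable_lin: "extractable (\<lambda>c. lin c b)"
proof -
  have "extractable oinv"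
    unfolding oinv_eq by (rule extractable_linear) (simp_all add: mswap_hom)
  moreover have "oinv c * om c = 1" for c
    by (simp only: mult.commute[of "oinv c"] om_oinv)
  ultimately have "extractable om"
    using only_first_basic(1) by (rule extractable_inverse)
  then show ?thesis
    unfolding lin_eq_xi
    by (intro extractable_mult extractable_linear) (simp_all add: mswap_hom(1,3,8) sw_mult)
qed

text \<open>Row \<open>i\<close> and column \<open>j\<close> are numbered from 0; the entry in column \<open>j\<close> is symmetric in
  \<open>x\<^sub>1, \<dots>, x\<^bsub>P j + 1\<^esub>\<close>.\<close>

definition chain_det :: "nat \<Rightarrow> (nat \<Rightarrow> xy_series) \<Rightarrow> (nat \<Rightarrow> nat) \<Rightarrow> xy_series" where
  "chain_det r f P = det (mat r r (\<lambda>(i, j). iso_chain (P j) (om (Suc 0) ^ i * oinv (Suc 0) ^ j * f i)))"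

lemma om_power_cancel:
  assumes "a + d = b + c"
  shows "om i ^ a * oinv i ^ b = om i ^ c * oinv i ^ d"
proof -
  have one: "om i ^ n * oinv i ^ n = 1" for n
    by (simp only: power_mult_distrib[symmetric] om_oinv power_one)
  have "om i ^ a * oinv i ^ b = om i ^ a * oinv i ^ b * (om i ^ d * oinv i ^ d)"
    by (simp only: one mult_1_right)
  also have "\<dots> = om i ^ (a + d) * oinv i ^ (b + d)"
    by (simp only: power_add ac_simps)
  also have "\<dots> = om i ^ c * oinv i ^ d * (om i ^ b * oinv i ^ b)"
    unfolding assms by (simp only: power_add ac_simps)
  finally show ?thesis
    by (simp only: one mult_1_right)
qed

lemma divdiff_eq_chain_entry:
  assumes "only_first f" "k + i = s + j"
  shows "divdiff (Suc k) (oinv (Suc 0) ^ s * f) = iso_chain k (om (Suc 0) ^ j * oinv (Suc 0) ^ i * f)"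
proof -
  have "divdiff (Suc k) (oinv (Suc 0) ^ s * f) = iso_chain k (om (Suc 0) ^ k * (oinv (Suc 0) ^ s * f))"
    using assms(1) by (intro divdiff_eq_iso_chain only_first_intros)
  then show ?thesis
    using om_power_cancel[OF assms(2)] by (simp only: mult.assoc[symmetric])
qed

text \<open>At the minimal positions \<open>divdiff\<close> absorbs the column-dependent power of
  \<open>om\<close>, and what remains depends on the row only.\<close>

lemma chain_det_eq_ddet:
  assumes "\<forall>i<r. only_first (f i)"
  shows "chain_det r f (\<lambda>j. r - 1 - j) = ddet r (\<lambda>i. oinv (Suc 0) ^ (r - 1 - i) * f i)"
  unfolding chain_det_def ddet_def
proof (intro arg_cong[of _ _ det] eq_matI)
  fix i j assume "i < dim_row (mat r r (\<lambda>(i, j). divdiff (r - j) (oinv (Suc 0) ^ (r - 1 - i) * f i)))"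
    "j < dim_col (mat r r (\<lambda>(i, j). divdiff (r - j) (oinv (Suc 0) ^ (r - 1 - i) * f i)))"
  then have ij: "i < r" "j < r" by auto
  then have "divdiff (Suc (r - 1 - j)) (oinv (Suc 0) ^ (r - 1 - i) * f i)
      = iso_chain (r - 1 - j) (om (Suc 0) ^ i * oinv (Suc 0) ^ j * f i)"
    using assms by (intro divdiff_eq_chain_entry) auto
  then show "mat r r (\<lambda>(i, j). iso_chain (r - 1 - j) (om (Suc 0) ^ i * oinv (Suc 0) ^ j * f i)) $$ (i, j)
      = mat r r (\<lambda>(i, j). divdiff (r - j) (oinv (Suc 0) ^ (r - 1 - i) * f i)) $$ (i, j)"
    using ij by (simp add: Suc_diff_Suc)
qed auto

lemma chain_det_extract:
  assumes \<phi>: "extractable \<phi>" and f: "\<forall>i<r. only_first (f i)"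
  shows "chain_det r (\<lambda>i. \<phi> (Suc 0) * f i) (\<lambda>j. r - 1 - j) = (\<Prod>c\<in>{1..r}. \<phi> c) * chain_det r f (\<lambda>j. r - 1 - j)"
proof -
  have first: "only_first (\<phi> (Suc 0))"
    using \<phi> by (simp add: extractable_def)
  have "chain_det r (\<lambda>i. \<phi> (Suc 0) * f i) (\<lambda>j. r - 1 - j)
      = ddet r (\<lambda>i. \<phi> (Suc 0) * (oinv (Suc 0) ^ (r - 1 - i) * f i))"
    using f first by (subst chain_det_eq_ddet) (simp_all add: only_first_mult ac_simps)
  also have "\<dots> = (\<Prod>c\<in>{1..r}. \<phi> c) * ddet r (\<lambda>i. oinv (Suc 0) ^ (r - 1 - i) * f i)"
    using \<phi> f unfolding extractable_def by (simp add: only_first_intros)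
  finally show ?thesis
    unfolding chain_det_eq_ddet[OF f] .
qed

lemma divdiff_1: "divdiff k 1 = (if k = 1 then 1 else 0)"
proof (induction k)
  case (Suc k)
  then show ?case
    by (cases "k = 0"; cases "k = 1") (simp_all add: tau_sym mswap_hom)
qed simp

text \<open>As \<open>f r = 1\<close>, the last row of divided differences is
  \<open>0, ..., 0, 1\<close> and can be deleted with the last column. The remaining positions
  \<open>r - j\<close> are one above the minimal ones for size \<open>r\<close>.\<close>

lemma chain_det_last_row:
  assumes f: "\<forall>i<r. only_first (f i)" and "f r = 1"
  shows "chain_det (Suc r) f (\<lambda>j. r - j) = chain_det r f (\<lambda>j. r - j)"
proof -
  let ?g = "\<lambda>i. oinv (Suc 0) ^ (r - i) * f i"
  let ?A = "mat (Suc r) (Suc r) (\<lambda>(i, j). divdiff (Suc r - j) (?g i))"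
  have f': "\<forall>i<Suc r. only_first (f i)"
    using assms by (auto simp: less_Suc_eq only_first_1)
  have "chain_det (Suc r) f (\<lambda>j. r - j) = det ?A"
    using chain_det_eq_ddet[OF f'] by (simp add: ddet_def)
  also have "\<dots> = (\<Sum>j<Suc r. ?A $$ (r, j) * cofactor ?A r j)"
    by (rule laplace_expansion_row) auto
  also have "\<dots> = (\<Sum>j<Suc r. if j = r then cofactor ?A r r else 0)"
    by (rule sum.cong) (auto simp: assms(2) divdiff_1)
  also have "\<dots> = det (mat_delete ?A r r)"
    by (simp add: cofactor_def)
  also have "mat_delete ?A r r = mat r r (\<lambda>(i, j). iso_chain (r - j) (om (Suc 0) ^ i * oinv (Suc 0) ^ j * f i))"
    (is "_ = ?B")
  proof (rule eq_matI)
    fix i j assume "i < dim_row ?B" "j < dim_col ?B"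
    then have ij: "i < r" "j < r" by auto
    have "divdiff (Suc (r - j)) (?g i) = iso_chain (r - j) (om (Suc 0) ^ i * oinv (Suc 0) ^ j * f i)"
      using ij f by (intro divdiff_eq_chain_entry) auto
    then show "mat_delete ?A r r $$ (i, j) = ?B $$ (i, j)"
      using ij by (simp add: mat_delete_def Suc_diff_le)
  qed (auto simp: mat_delete_def)
  finally show ?thesis
    by (simp add: chain_det_def)
qed

section \<open>Operators acting on a single column of a determinant\<close>

lemma mswap_det:
  fixes A :: "('v, 'a::comm_ring_1) mfps mat"
  assumes "involution \<sigma>" "A \<in> carrier_mat n n"
  shows "mswap \<sigma> (det A) = det (map_mat (mswap \<sigma>) A)"
proof -
  have "mswap \<sigma> (signof p) = (signof p :: ('v, 'a) mfps)" for p :: "nat \<Rightarrow> nat"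
    using assms(1) by (simp add: sign_def mswap_hom)
  then have "mswap \<sigma> (det A) = (\<Sum>p | p permutes {0..<n}. signof p * (\<Prod>i = 0..<n. mswap \<sigma> (A $$ (i, p i))))"
    unfolding det_def'[OF assms(2)] by (simp add: mswap_sum mswap_prod mswap_hom(4) assms(1))
  also have "\<dots> = det (map_mat (mswap \<sigma>) A)"
  proof (subst det_def'[of _ n])
    have "mswap \<sigma> (A $$ (i, p i)) = map_mat (mswap \<sigma>) A $$ (i, p i)"
      if "p permutes {0..<n}" "i \<in> {0..<n}" for p i
      using permutes_in_image[OF that(1), of i] that(2) assms(2) by simp
    then show "(\<Sum>p | p permutes {0..<n}. signof p * (\<Prod>i = 0..<n. mswap \<sigma> (A $$ (i, p i))))
        = (\<Sum>p | p permutes {0..<n}. signof p * (\<Prod>i = 0..<n. map_mat (mswap \<sigma>) A $$ (i, p i)))"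
      by (intro sum.cong prod.cong arg_cong2[of _ _ _ _ "(*)"]) auto
  qed (use assms(2) in auto)
  finally show ?thesis .
qed

text \<open>In the expansion along column \<open>j\<close> the cofactors are invariant under the
  swap, so the operator acts on the entries of that column only.\<close>

lemma isobaric_det_column:
  assumes A: "A \<in> carrier_mat n n" and B: "B \<in> carrier_mat n n" and j: "j < n"
    and sym: "\<And>i l. i < n \<Longrightarrow> l < n \<Longrightarrow> l \<noteq> j \<Longrightarrow> sw k (A $$ (i, l)) = A $$ (i, l) \<and> B $$ (i, l) = A $$ (i, l)"
    and col: "\<And>i. i < n \<Longrightarrow> B $$ (i, j) = isobaric k (A $$ (i, j))"
  shows "isobaric k (det A) = det B"
proof (rule isobaric_eqI)
  let ?A' = "map_mat (sw k) A"
  have cof: "cofactor C i j = cofactor A i j" if "C \<in> carrier_mat n n" "i < n"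
    "\<And>i l. i < n \<Longrightarrow> l < n \<Longrightarrow> l \<noteq> j \<Longrightarrow> C $$ (i, l) = A $$ (i, l)" for C i
  proof -
    have "mat_delete C i j = mat_delete A i j"
      by (rule eq_matI) (use that A j in \<open>auto simp: mat_delete_def\<close>)
    then show ?thesis by (simp add: cofactor_def)
  qed
  have exp: "det C = (\<Sum>i<n. C $$ (i, j) * cofactor A i j)" if C: "C \<in> carrier_mat n n"
    "\<And>i l. i < n \<Longrightarrow> l < n \<Longrightarrow> l \<noteq> j \<Longrightarrow> C $$ (i, l) = A $$ (i, l)" for C
    unfolding laplace_expansion_column[OF C(1) j]
    by (rule sum.cong) (simp_all add: cof[OF C(1) _ C(2)])
  have "det B = (\<Sum>i<n. B $$ (i, j) * cofactor A i j)"
    by (rule exp[OF B]) (use sym in auto)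
  also have "\<dots> = (\<Sum>i<n. isobaric k (A $$ (i, j)) * cofactor A i j)"
    by (simp add: col)
  finally have "det B * (xv k - xv (Suc k))
      = (\<Sum>i<n. isobaric k (A $$ (i, j)) * cofactor A i j * (xv k - xv (Suc k)))"
    by (simp only: sum_distrib_right)
  also have "\<dots> = (\<Sum>i<n. (isobaric k (A $$ (i, j)) * (xv k - xv (Suc k))) * cofactor A i j)"
    by (simp only: ac_simps)
  also have "\<dots> = om (Suc k) * (\<Sum>i<n. A $$ (i, j) * cofactor A i j)
      - om k * (\<Sum>i<n. ?A' $$ (i, j) * cofactor A i j)"
    unfolding isobaric_mult_diff sum_distrib_left sum_subtractf[symmetric]
    by (rule sum.cong) (use A j in \<open>simp_all add: algebra_simps\<close>)
  also have "(\<Sum>i<n. ?A' $$ (i, j) * cofactor A i j) = det ?A'"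
    by (rule exp[symmetric]) (use A sym in auto)
  also have "det ?A' = sw k (det A)"
    using A by (simp add: mswap_det)
  also have "(\<Sum>i<n. A $$ (i, j) * cofactor A i j) = det A"
    by (rule exp[symmetric]) (use A in auto)
  finally show "det B * (xv k - xv (Suc k)) = om (Suc k) * det A - om k * sw k (det A)" .
qed

text \<open>The swapped variables \<open>x_{k+1}, x_{k+2}\<close> lie beyond the chain of a column
  with \<open>P l < k\<close> and among the symmetric variables of one with \<open>P l > k\<close>;
  only column \<open>j\<close> moves.\<close>

lemma isobaric_chain_det:
  assumes f: "\<forall>i<r. only_first (f i)" and j: "j < r"
    and P: "P j = k" "\<And>l. l < r \<Longrightarrow> l \<noteq> j \<Longrightarrow> P l \<noteq> k"
    and F: "sw (Suc k) F = F"
  shows "isobaric (Suc k) (F * chain_det r f P) = F * chain_det r f (P(j := Suc k))"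
proof -
  have "isobaric (Suc k) (chain_det r f P) = chain_det r f (P(j := Suc k))"
    unfolding chain_det_def
  proof (rule isobaric_det_column[OF _ _ j])
    fix i l assume il: "i < r" "l < r" "l \<noteq> j"
    let ?g = "om (Suc 0) ^ i * oinv (Suc 0) ^ l * f i"
    have g: "only_first ?g"
      using il f by (intro only_first_intros) auto
    have "P l < k \<or> Suc k \<le> P l"
      using P(2)[OF il(2,3)] by linarith
    then have "sw (Suc k) (iso_chain (P l) ?g) = iso_chain (P l) ?g"
      using sw_iso_chain_far[OF g] sw_iso_chain_near[OF g] by auto
    then show "sw (Suc k) (mat r r (\<lambda>(i, j). iso_chain (P j) (om (Suc 0) ^ i * oinv (Suc 0) ^ j * f i)) $$ (i, l))
        = mat r r (\<lambda>(i, j). iso_chain (P j) (om (Suc 0) ^ i * oinv (Suc 0) ^ j * f i)) $$ (i, l) \<and>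
      mat r r (\<lambda>(i, l). iso_chain ((P(j := Suc k)) l) (om (Suc 0) ^ i * oinv (Suc 0) ^ l * f i)) $$ (i, l)
        = mat r r (\<lambda>(i, j). iso_chain (P j) (om (Suc 0) ^ i * oinv (Suc 0) ^ j * f i)) $$ (i, l)"
      using il by simp
  qed (use j P in auto)
  then show ?thesis
    by (simp add: isobaric_mult_left F)
qed


section \<open>Determinants for 321-avoiding permutations\<close>

definition lin_prod :: "nat \<Rightarrow> nat \<Rightarrow> xy_series" where
  "lin_prod n c = (\<Prod>b\<in>{1..n}. lin c b)"

lemma only_first_lin_prod: "only_first (lin_prod n (Suc 0))"
  unfolding lin_prod_def by (intro only_first_intros)

lemma extractable_lin_prod: "extractable (lin_prod n)"
  unfolding lin_prod_def by (intro extractable_prod extractable_lin)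

lemma sw_lin_prod [simp]:
  "sw i (lin_prod n i) = lin_prod n (Suc i)" "sw i (lin_prod n (Suc i)) = lin_prod n i"
  "j \<noteq> i \<Longrightarrow> j \<noteq> Suc i \<Longrightarrow> sw i (lin_prod n j) = lin_prod n j"
  by (simp_all add: lin_prod_def mswap_prod)

lemma sw_lin_prod_sym:
  assumes "1 \<le> k" "k < r"
  shows "sw k (\<Prod>c\<in>{1..r}. lin_prod n c) = (\<Prod>c\<in>{1..r}. lin_prod n c)"
proof -
  have split: "{1..r} = insert k (insert (Suc k) ({1..r} - {k, Suc k}))"
    using assms by auto
  show ?thesis
    by (subst (1 2) split) (simp add: sw_mult mswap_prod ac_simps)
qed

lemma chain_det_cong:
  assumes "\<And>i. i < r \<Longrightarrow> f i = g i" "\<And>j. j < r \<Longrightarrow> P j = Q j"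
  shows "chain_det r f P = chain_det r g Q"
  unfolding chain_det_def by (intro arg_cong[of _ _ det] eq_matI) (auto simp: assms)

lemma chain_det_0: "chain_det 0 f P = 1"
  by (simp add: chain_det_def)

section \<open>From dominant to Grassmannian permutations\<close>

lemma code_eq_pred:
  assumes w: "w permutes {1..N}" and i: "1 \<le> i" "i \<le> N"
    and before: "\<And>b. 1 \<le> b \<Longrightarrow> b < i \<Longrightarrow> w i < w b"
  shows "code N w i = w i - 1"
proof -
  let ?S = "{b. i < b \<and> b \<le> N \<and> w b < w i}"
  have "w ` ?S = {1..<w i}"
  proof
    show "w ` ?S \<subseteq> {1..<w i}"
      using permutes_in_image[OF w] i by force
    show "{1..<w i} \<subseteq> w ` ?S"
    proof
      fix v assume v: "v \<in> {1..<w i}"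
      moreover have "w i \<le> N"
        using permutes_in_image[OF w, of i] i by simp
      ultimately obtain b where b: "b \<in> {1..N}" "w b = v"
        using permutes_image[OF w] by (metis atLeastAtMost_iff atLeastLessThan_iff imageE le_trans less_imp_le)
      have "i < b"
        using before[of b] b v by (cases b i rule: linorder_cases) auto
      then show "v \<in> w ` ?S"
        using b v by auto
    qed
  qed
  moreover have "card (w ` ?S) = card ?S"
    by (rule card_image) (use permutes_inj[OF w] in \<open>auto simp: inj_on_def\<close>)
  ultimately show ?thesis
    by (simp add: code_def)
qed

text \<open>\<open>r\<close> interpolates between the dominant permutation (\<open>r = 0\<close>)
  and the Grassmannian one (\<open>r = t\<close>): the first \<open>r\<close> values are already
  reversed into increasing order.\<close>

lemma reach_grassmannian:
  assumes w: "w permutes {1..N}" and "r \<le> t" "t \<le> N"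
    and q: "\<And>i j. 1 \<le> i \<Longrightarrow> i < j \<Longrightarrow> j \<le> t \<Longrightarrow> q j < q i"
    and up: "\<And>b. 1 \<le> b \<Longrightarrow> b \<le> r \<Longrightarrow> w b = q (r + 1 - b) + 1"
    and down: "\<And>b. r < b \<Longrightarrow> b \<le> t \<Longrightarrow> w b = q b + 1"
    and rest: "\<And>b. t < b \<Longrightarrow> w b < w (Suc b)"
  shows "reach N w (chain_det r (\<lambda>i. lin_prod (q (Suc i)) (Suc 0)) (\<lambda>j. r - 1 - j)
    * (\<Prod>i\<in>{Suc r..t}. lin_prod (q i) i))"
  using \<open>r \<le> t\<close> w up down rest
proof (induction r arbitrary: w)
  case 0
  note w = 0(2) and down = 0(4) and rest = 0(5)
  have code1: "code N w i = q i" if "1 \<le> i" "i \<le> t" for i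
  proof -
    have "code N w i = w i - 1"
      by (rule code_eq_pred[OF w]) (use that \<open>t \<le> N\<close> down q in auto)
    then show ?thesis using that down by simp
  qed
  have mono: "w i < w j" if "t < i" "i < j" for i j
    using that(2,1)
  proof (induction rule: less_Suc_induct)
    case (1 i) then show ?case by (rule rest)
  next
    case (2 i j k) then show ?case by (meson less_trans)
  qed
  have code2: "code N w i = 0" if "t < i" for i
    using mono[OF that] unfolding code_def by (auto simp: card_eq_0_iff dest: less_asym)
  have "reach N w (dominant_prod N w)"
  proof (rule reach_dominant[OF w])
    fix i assume "1 \<le> i" "i < N"
    then show "code N w (Suc i) \<le> code N w i"
      using code1[of i] code1[of "Suc i"] code2[of "Suc i"] q[of i "Suc i"]
      by (cases "Suc i \<le> t") auto
  qed
  moreover have "dominant_prod N w = (\<Prod>i\<in>{Suc 0..t}. lin_prod (q i) i)"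
  proof -
    have "dominant_prod N w = (\<Prod>i\<in>{1..t}. \<Prod>b\<in>{1..code N w i}. lin i b)"
      unfolding dominant_prod_def
      by (rule prod.mono_neutral_right) (use \<open>t \<le> N\<close> code2 in auto)
    then show ?thesis
      by (simp add: code1 lin_prod_def)
  qed
  ultimately show ?case
    by (simp add: chain_det_0)
next
  case (Suc r)
  note w = Suc.prems(2) and rt = Suc.prems(1) and up = Suc.prems(3) and down = Suc.prems(4)
    and rest = Suc.prems(5)
  let ?m = "q (Suc r)"
  define f where "f = (\<lambda>i. lin_prod (q (Suc i)) (Suc 0))"
  define h where "h = (\<lambda>i. \<Prod>b\<in>{Suc ?m..q (Suc i)}. lin (Suc 0) b)"
  \<comment> \<open>In \<open>u k\<close> the first value of \<open>w\<close> sits at position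
    \<open>k\<close>. The path runs from \<open>u (Suc r)\<close>, covered by the induction
    hypothesis, down to \<open>u 1 = w\<close>.\<close>
  define u where "u = (\<lambda>k b. if 1 \<le> b \<and> b < k then w (Suc b) else if b = k then w 1 else w b)"
  have f_first: "only_first (f i)" for i
    by (simp add: f_def only_first_lin_prod)
  have h_first: "only_first (h i)" for i
    unfolding h_def by (intro only_first_intros)
  have f_h: "f i = lin_prod ?m (Suc 0) * h i" if "i \<le> r" for i
  proof -
    have "?m \<le> q (Suc i)"
      using q[of "Suc i" "Suc r"] that rt by (cases "i = r") auto
    then have "{1..q (Suc i)} = {1..?m} \<union> {Suc ?m..q (Suc i)}"
      by auto
    then show ?thesis
      unfolding f_def h_def lin_prod_def by (simp only:) (rule prod.union_disjoint, auto)
  qed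
  have h_r: "h r = 1"
    by (simp add: h_def)
  \<comment> \<open>Needed twice: with \<open>s = r\<close> at the start of the path and with
    \<open>s = Suc r\<close> at its end.\<close>
  have pull_out: "chain_det s f (\<lambda>j. s - 1 - j)
      = (\<Prod>c\<in>{1..s}. lin_prod ?m c) * chain_det s h (\<lambda>j. s - 1 - j)" if "s \<le> Suc r" for s
  proof -
    have "chain_det s f (\<lambda>j. s - 1 - j) = chain_det s (\<lambda>i. lin_prod ?m (Suc 0) * h i) (\<lambda>j. s - 1 - j)"
      by (rule chain_det_cong) (use that f_h in auto)
    then show ?thesis
      using chain_det_extract[OF extractable_lin_prod, of s h ?m] h_first by simp
  qed
  have u_adj: "u (Suc k) = u k \<circ> adj k" if "1 \<le> k" for k
    using that by (auto simp: u_def fun_eq_iff transpose_def)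
  have u_1: "u 1 = w"
    by (auto simp: u_def fun_eq_iff)
  have u_perm: "1 \<le> k \<Longrightarrow> k \<le> Suc r \<Longrightarrow> u k permutes {1..N}" for k
  proof (induction k rule: nat_induct_at_least)
    case base
    then show ?case using u_1 w by simp
  next
    case (Suc k)
    then show ?case
      unfolding u_adj[OF Suc.hyps] using rt \<open>t \<le> N\<close> by (intro comp_adj_permutes) auto
  qed
  let ?T = "\<Prod>i\<in>{Suc (Suc r)..t}. lin_prod (q i) i"
  let ?G = "(\<Prod>c\<in>{1..Suc r}. lin_prod ?m c) * ?T"
  \<comment> \<open>Column positions at stage \<open>k\<close>, where \<open>k\<close> falls from
    \<open>Suc r\<close> to 1: the columns with \<open>r - j \<ge> k\<close> have already moved up
    by one.\<close>
  let ?P = "\<lambda>k j. if r - j < k then r - 1 - j else r - j"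
  have chain: "reach N (u k) (?G * chain_det r h (?P k))" if "1 \<le> k" "k \<le> Suc r" for k
    using that(2,1)
  proof (induction k rule: inc_induct)
    case base
    have "reach N (u (Suc r)) (chain_det r f (\<lambda>j. r - 1 - j) * (\<Prod>i\<in>{Suc r..t}. lin_prod (q i) i))"
      unfolding f_def
    proof (rule Suc.IH)
      show "u (Suc r) permutes {1..N}"
        using u_perm[of "Suc r"] by simp
      show "u (Suc r) b = q (r + 1 - b) + 1" if "1 \<le> b" "b \<le> r" for b
        using that up[of "Suc b"] by (simp add: u_def)
      show "u (Suc r) b = q b + 1" if "r < b" "b \<le> t" for b
        using that up[of 1] down[of b] by (auto simp: u_def)
      show "u (Suc r) b < u (Suc r) (Suc b)" if "t < b" for b
        using that rest[of b] rt by (auto simp: u_def)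
    qed (use rt in simp)
    \<comment> \<open>The factor for row \<open>r + 1\<close> completes the extracted product to one
      over \<open>x_1, ..., x_{r+1}\<close>, which every operator on the path leaves
      invariant.\<close>
    moreover have "(\<Prod>i\<in>{Suc r..t}. lin_prod (q i) i) = lin_prod ?m (Suc r) * ?T"
      using rt by (rule prod.atLeast_Suc_atMost)
    moreover have "chain_det r h (?P (Suc r)) = chain_det r h (\<lambda>j. r - 1 - j)"
      by (rule chain_det_cong) auto
    ultimately show ?case
      using pull_out[of r] by (simp add: ac_simps)
  next
    case (step k)
    have k: "1 \<le> k" "k \<le> r"
      using step by auto
    have "sw k ?T = ?T"
      unfolding mswap_prod[OF involution_transpose] by (rule prod.cong) (use k in auto)
    moreover have "sw k (\<Prod>c\<in>{1..Suc r}. lin_prod ?m c) = (\<Prod>c\<in>{1..Suc r}. lin_prod ?m c)"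
      using k by (intro sw_lin_prod_sym) auto
    ultimately have G: "sw k ?G = ?G"
      by (simp only: sw_mult)
    have "isobaric (Suc (k - 1)) (?G * chain_det r h (?P (Suc k)))
        = ?G * chain_det r h ((?P (Suc k))(r - k := Suc (k - 1)))"
      using k G h_first by (intro isobaric_chain_det) auto
    also have "chain_det r h ((?P (Suc k))(r - k := Suc (k - 1))) = chain_det r h (?P k)"
      by (rule chain_det_cong) (use k in auto)
    finally have iso: "isobaric k (?G * chain_det r h (?P (Suc k))) = ?G * chain_det r h (?P k)"
      using k by simp
    have "w 1 = ?m + 1" "w (Suc k) = q (Suc r - k) + 1"
      using up[of 1] up[of "Suc k"] k by auto
    then have less: "u k k < u k (Suc k)"
      using q[of "Suc r - k" "Suc r"] rt k by (auto simp: u_def)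
    have "reach N (u k) (isobaric k (?G * chain_det r h (?P (Suc k))))"
      using step k by (intro reach_up less) (simp_all flip: u_adj)
    then show ?case
      unfolding iso .
  qed
  have "chain_det r h (?P 1) = chain_det r h (\<lambda>j. r - j)"
    by (rule chain_det_cong) auto
  \<comment> \<open>After extraction row \<open>r + 1\<close> is 1, so the determinant can be
    enlarged before the common factor is put back.\<close>
  also have "\<dots> = chain_det (Suc r) h (\<lambda>j. Suc r - 1 - j)"
    using chain_det_last_row[of r h] h_first h_r by simp
  finally have "?G * chain_det r h (?P 1) = chain_det (Suc r) f (\<lambda>j. Suc r - 1 - j) * ?T"
    unfolding pull_out[OF order_refl] by (simp only: ac_simps)
  then show ?case
    using chain[of 1] by (simp add: u_1[unfolded One_nat_def] f_def)
qed

text \<open>If no \<open>p j\<close> can be lowered by one, the last position is 1, and going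
  backwards each position exceeds the next one by exactly 1.\<close>

lemma staircase_positions:
  fixes p :: "nat \<Rightarrow> nat"
  assumes p: "\<And>i j. 1 \<le> i \<Longrightarrow> i < j \<Longrightarrow> j \<le> t \<Longrightarrow> p j < p i" and pos: "\<And>i. i \<in> {1..t} \<Longrightarrow> 0 < p i"
    and full: "\<And>j. j \<in> {1..t} \<Longrightarrow> 2 \<le> p j \<Longrightarrow> p j - 1 \<in> p ` {1..t}"
    and i: "1 \<le> i" "i \<le> t"
  shows "p i = t + 1 - i"
  using i(2,1)
proof (induction i rule: inc_induct)
  case base
  have "\<not> 2 \<le> p t"
  proof
    assume "2 \<le> p t"
    then obtain l where "l \<in> {1..t}" "p l = p t - 1"
      using full[of t] base by auto
    then show False
      using p[of l t] \<open>2 \<le> p t\<close> by (cases "l = t") auto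
  qed
  then show ?case
    using pos[of t] base by simp
next
  case (step i)
  have less: "p (Suc i) < p i" "0 < p (Suc i)"
    using step p[of i "Suc i"] pos[of "Suc i"] by auto
  then have "p i - 1 \<in> p ` {1..t}"
    using step by (intro full) auto
  then obtain l where l: "l \<in> {1..t}" "p l = p i - 1"
    by (metis imageE)
  have "i < l"
    using p[of l i] l less step by (cases l i rule: linorder_cases) auto
  then have "p l \<le> p (Suc i)"
    using p[of "Suc i" l] l by (cases "l = Suc i") auto
  then show ?case
    using l less step by simp
qed

text \<open>Induction on the sum of the positions. A \<open>p j\<close> that can be lowered by one
  gives \<open>w \<circ> adj k\<close>; if there is none, \<open>w\<close> is Grassmannian.\<close>

lemma reach_associated:
  assumes "w permutes {1..N}" "t \<le> N"
    and q: "\<And>i j. 1 \<le> i \<Longrightarrow> i < j \<Longrightarrow> j \<le> t \<Longrightarrow> q j < q i"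
    and "\<And>i j. 1 \<le> i \<Longrightarrow> i < j \<Longrightarrow> j \<le> t \<Longrightarrow> p j < p i" "\<And>i. i \<in> {1..t} \<Longrightarrow> 0 < p i"
    and "\<And>i. i \<in> {1..t} \<Longrightarrow> p i \<le> N" "\<And>i. i \<in> {1..t} \<Longrightarrow> p i \<le> q i + 1"
    and "associated t p q w"
  shows "reach N w (chain_det t (\<lambda>i. lin_prod (q (Suc i)) (Suc 0)) (\<lambda>j. p (Suc j) - 1))"
  using assms(1,4-)
proof (induction "\<Sum>i\<in>{1..t}. p i" arbitrary: p w rule: less_induct)
  case less
  note w = less.prems(1) and p = less.prems(2) and pos = less.prems(3) and pN = less.prems(4)
    and pq = less.prems(5) and assoc = less.prems(6)
  let ?f = "\<lambda>i. lin_prod (q (Suc i)) (Suc 0)"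
  let ?C = "{1..} - p ` {1..t}"
  have wp: "w (p i) = q i + 1" if "i \<in> {1..t}" for i
    using assoc that by (simp add: associated_def)
  have mono: "w a < w b" if "a \<in> ?C" "b \<in> ?C" "a < b" for a b
    using assoc that unfolding associated_def by (meson strict_mono_onD)
  have img: "w ` ?C = {1..} - (\<lambda>i. q i + 1) ` {1..t}"
    using assoc by (simp add: associated_def)
  show ?case
  proof (cases "\<exists>j\<in>{1..t}. 2 \<le> p j \<and> p j - 1 \<notin> p ` {1..t}")
    case False
    then have p_eq: "p i = t + 1 - i" if "1 \<le> i" "i \<le> t" for i
      using staircase_positions[of t p i, OF p pos _ that] by blast
    have "p ` {1..t} = {1..t}"
    proof
      show "{1..t} \<subseteq> p ` {1..t}"
      proof
        fix b assume "b \<in> {1..t}"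
        then show "b \<in> p ` {1..t}"
          using p_eq[of "t + 1 - b"] by (intro image_eqI[of _ _ "t + 1 - b"]) auto
      qed
    qed (use p_eq in auto)
    then have C: "?C = {t<..}"
      by auto
    have "reach N w (chain_det t ?f (\<lambda>j. t - 1 - j) * (\<Prod>i\<in>{Suc t..t}. lin_prod (q i) i))"
    proof (rule reach_grassmannian[OF w order_refl \<open>t \<le> N\<close>])
      show "w b = q (t + 1 - b) + 1" if "1 \<le> b" "b \<le> t" for b
      proof -
        have "t + 1 - b \<in> {1..t}" "p (t + 1 - b) = b"
          using that p_eq[of "t + 1 - b"] by auto
        then show ?thesis
          using wp[of "t + 1 - b"] by simp
      qed
      show "w b < w (Suc b)" if "t < b" for b
      proof (rule mono)
        show "b \<in> ?C" "Suc b \<in> ?C"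
          unfolding C using that by auto
      qed simp
    qed (use q in auto)
    moreover have "chain_det t ?f (\<lambda>j. t - 1 - j) = chain_det t ?f (\<lambda>j. p (Suc j) - 1)"
      by (rule chain_det_cong) (auto simp: p_eq)
    ultimately show ?thesis
      by simp
  next
    case True
    then obtain j where j: "1 \<le> j" "j \<le> t" and "2 \<le> p j" "p j - 1 \<notin> p ` {1..t}"
      by auto
    define k where "k = p j - 1"
    have k: "1 \<le> k" "p j = Suc k" "k \<notin> p ` {1..t}"
      using \<open>2 \<le> p j\<close> \<open>p j - 1 \<notin> p ` {1..t}\<close> by (auto simp: k_def)
    have kN: "k < N"
      using pN[of j] k j by simp
    have kC: "k \<in> ?C"
      using k by simp
    define p' where "p' = p(j := k)"
    have p_neq: "p i \<noteq> k" "i \<noteq> j \<Longrightarrow> p i \<noteq> Suc k" if "i \<in> {1..t}" for i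
      using k p[of i j] p[of j i] that j by (auto simp: linorder_neq_iff[of i j])
    let ?C' = "{1..} - p' ` {1..t}"
    have C': "b \<in> ?C' \<longleftrightarrow> adj k b \<in> ?C" for b
    proof -
      have "p' ` {1..t} = insert k (p ` ({1..t} - {j}))" "p ` {1..t} = insert (Suc k) (p ` ({1..t} - {j}))"
        using j k(2)[symmetric] by (auto simp: p'_def)
      moreover have "k \<notin> p ` ({1..t} - {j})"
        using k(3) by blast
      moreover have "Suc k \<notin> p ` ({1..t} - {j})"
      proof
        assume "Suc k \<in> p ` ({1..t} - {j})"
        then obtain x where "Suc k = p x" "x \<in> {1..t}" "x \<noteq> j"
          by blast
        then show False
          using p_neq(2)[of x] by simp
      qed
      ultimately show ?thesis
        using k(1) by (cases "b = k"; cases "b = Suc k") auto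
    qed
    \<comment> \<open>This uses \<open>p j \<le> q j + 1\<close>: if
      \<open>w k > w (Suc k) = q j + 1\<close>, the values \<open>1, ..., q j\<close> would all
      occur before position \<open>k\<close>, forcing \<open>q j < k = p j - 1\<close>.\<close>
    have less: "w k < w (Suc k)"
    proof (rule ccontr)
      assume "\<not> w k < w (Suc k)"
      then have gt: "q j + 1 < w k"
        using wp[of j] j k permutes_neq[OF w, of k] by auto
      have "{1..q j} \<subseteq> w ` {1..<k}"
      proof
        fix v assume v: "v \<in> {1..q j}"
        obtain b where b: "w b = v"
          using permutes_surj[OF w] by (metis surjD)
        have "1 \<le> b"
          using b v permutes_not_in[OF w, of 0] by (cases b) auto
        have "b < k"
        proof (cases "b \<in> ?C")
          case True
          then show ?thesis
            using mono[OF kC True] gt v b by (cases b k rule: linorder_cases) auto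
        next
          case False
          then obtain l where l: "l \<in> {1..t}" "b = p l"
            using \<open>1 \<le> b\<close> by auto
          then have "q l < q j"
            using wp[of l] b v by auto
          then have "j < l"
            using q[of l j] l j by (cases l j rule: linorder_cases) auto
          then show ?thesis
            using p[of j l] p_neq(1)[of l] l j k by auto
        qed
        then show "v \<in> w ` {1..<k}"
          using b \<open>1 \<le> b\<close> by auto
      qed
      then have "card {1..q j} \<le> card {1..<k}"
        using surj_card_le by blast
      then show False
        using pq[of j] j k by simp
    qed
    have "reach N (w \<circ> adj k) (chain_det t ?f (\<lambda>j. p' (Suc j) - 1))"
    proof (rule less.hyps)
      show "sum p' {1..t} < sum p {1..t}"
        using j k by (intro sum_strict_mono_ex1) (auto simp: p'_def)
      show "w \<circ> adj k permutes {1..N}"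
        using w k kN by (intro comp_adj_permutes)
      show "p' l < p' i" if "1 \<le> i" "i < l" "l \<le> t" for i l
        using that p[of i l] p_neq(1)[of l] k by (auto simp: p'_def)
      show "associated t p' q (w \<circ> adj k)"
        unfolding associated_def
      proof (intro conjI ballI strict_mono_onI)
        show "(w \<circ> adj k) (p' i) = q i + 1" if "i \<in> {1..t}" for i
          using that wp[of i] p_neq[OF that] k by (auto simp: p'_def transpose_def)
        fix a b assume ab: "a \<in> ?C'" "b \<in> ?C'" "a < b"
        have "k \<notin> ?C'"
          using j by (auto simp: p'_def)
        then have "a \<noteq> k" "b \<noteq> k"
          using ab by auto
        then have "adj k a < adj k b"
          using ab by (auto simp: transpose_def)
        then show "(w \<circ> adj k) a < (w \<circ> adj k) b"
          unfolding comp_apply using ab C' by (intro mono) blast+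
      next
        have "adj k ` ?C' = ?C"
        proof (rule Set.set_eqI)
          fix b
          have "b \<in> adj k ` ?C' \<longleftrightarrow> adj k b \<in> ?C'"
            by (metis (no_types, lifting) image_iff transpose_involutory)
          then show "b \<in> adj k ` ?C' \<longleftrightarrow> b \<in> ?C"
            unfolding C' by simp
        qed
        then show "(w \<circ> adj k) ` ?C' = {1..} - (\<lambda>i. q i + 1) ` {1..t}"
          using img by (simp only: image_comp[symmetric])
      qed
    qed (use pos pN pq pq[of j] j k kN in \<open>auto simp: p'_def\<close>)
    then have "reach N w (isobaric k (chain_det t ?f (\<lambda>j. p' (Suc j) - 1)))"
      using k(1) less by (intro reach_up)
    moreover have "isobaric (Suc (k - 1)) (1 * chain_det t ?f (\<lambda>j. p' (Suc j) - 1))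
        = 1 * chain_det t ?f ((\<lambda>j. p' (Suc j) - 1)(j - 1 := Suc (k - 1)))"
    proof (rule isobaric_chain_det)
      fix l assume l: "l < t" "l \<noteq> j - 1"
      then have "p (Suc l) \<noteq> k" "0 < p (Suc l)"
        using p_neq(1)[of "Suc l"] pos[of "Suc l"] by auto
      then show "p' (Suc l) - 1 \<noteq> k - 1"
        using l k by (auto simp: p'_def)
    qed (use j in \<open>auto simp: only_first_lin_prod mswap_hom p'_def\<close>)
    moreover have "chain_det t ?f ((\<lambda>j. p' (Suc j) - 1)(j - 1 := Suc (k - 1)))
        = chain_det t ?f (\<lambda>j. p (Suc j) - 1)"
      by (rule chain_det_cong) (use j k in \<open>auto simp: p'_def\<close>)
    ultimately show ?thesis
      using k by simp
  qed
qed


section \<open>The entries of the determinant\<close>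

text \<open>The numerator is a Pochhammer symbol, hence divisible by \<open>fact k\<close>; this
  transfers Pascal's rule from the rationals.\<close>

lemma of_int_int_binomial: "rat_of_int (int_binomial s k) = of_int s gchoose k"
proof -
  have "int_binomial s k = pochhammer (s - int k + 1) k div fact k"
    using falling_fact_pochhammer'[of s k] by (simp add: int_binomial_def lessThan_atLeast0)
  then have "fact k * int_binomial s k = pochhammer (s - int k + 1) k"
    by (simp add: fact_dvd_pochhammer)
  then have "fact k * rat_of_int (int_binomial s k) = pochhammer (of_int (s - int k + 1)) k"
    by (metis of_int_mult of_int_fact pochhammer_of_int)
  then show ?thesis
    by (simp add: gbinomial_pochhammer' field_simps)
qed

lemma int_binomial_0 [simp]: "int_binomial s 0 = 1"
  by (simp add: int_binomial_def)

lemma int_binomial_Suc: "int_binomial (s + 1) (Suc k) = int_binomial s k + int_binomial s (Suc k)"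
proof -
  have "rat_of_int (int_binomial (s + 1) (Suc k)) = rat_of_int (int_binomial s k + int_binomial s (Suc k))"
    using gbinomial_Suc_Suc[of "rat_of_int s" k] by (simp add: of_int_int_binomial)
  then show ?thesis
    by (simp only: of_int_eq_iff)
qed

lemma int_binomial_pred: "int_binomial (int k - 1) k = (if k = 0 then 1 else 0)"
proof (cases k)
  case (Suc k')
  have "(\<Prod>i<k. int k - 1 - int i) = 0"
    by (rule prod_zero) (use Suc in auto)
  then show ?thesis
    using Suc by (simp add: int_binomial_def)
qed simp

section \<open>Weighted extraction of coefficients of \<open>u\<close>\<close>

definition icoeff :: "int poly poly \<Rightarrow> int \<Rightarrow> int poly" where
  "icoeff P n = (if n < 0 then 0 else poly.coeff P (nat n))"

text \<open>Coefficient of \<open>u\<^sup>m\<close> in \<open>(1 - \<beta>/u)\<^bsup>-s\<^esup> P(u)\<close>, expanded in powers of \<open>\<beta>/u\<close>.\<close>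

definition ucoeff :: "int \<Rightarrow> int \<Rightarrow> int poly poly \<Rightarrow> int poly" where
  "ucoeff s m P = Sum_any (\<lambda>k. of_int (int_binomial (s + int k - 1) k) * [:0, 1:] ^ k * icoeff P (m + int k))"

lemma icoeff_eq_0: "int (degree P) < n \<Longrightarrow> icoeff P n = 0"
  by (auto simp: icoeff_def intro!: coeff_eq_0)

lemma ucoeff_eq_sum:
  assumes "int (degree P) < m + int K"
  shows "ucoeff s m P = (\<Sum>k<K. of_int (int_binomial (s + int k - 1) k) * [:0, 1:] ^ k * icoeff P (m + int k))"
  unfolding ucoeff_def
proof (rule Sum_any.expand_superset)
  show "{k. of_int (int_binomial (s + int k - 1) k) * [:0, 1:] ^ k * icoeff P (m + int k) \<noteq> 0} \<subseteq> {..<K}"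
  proof (rule subsetI, rule ccontr)
    fix k assume k: "k \<in> {k. of_int (int_binomial (s + int k - 1) k) * [:0, 1:] ^ k * icoeff P (m + int k) \<noteq> 0}" "k \<notin> {..<K}"
    then have "icoeff P (m + int k) = 0"
      using assms by (intro icoeff_eq_0) simp
    then show False using k by simp
  qed
qed simp

text \<open>A common cut-off lets the sums for several polynomials be compared termwise.\<close>

lemma ucoeff_bound: "\<exists>K. \<forall>P\<in>set Ps. int (degree P) < m + int K"
proof (induction Ps)
  case (Cons P Ps)
  then obtain K where "\<forall>P\<in>set Ps. int (degree P) < m + int K" by blast
  then show ?case
    by (intro exI[of _ "max K (nat (int (degree P) - m + 1))"]) fastforce
qed simp

lemma icoeff_add: "icoeff (P + Q) n = icoeff P n + icoeff Q n"
  by (simp add: icoeff_def)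

lemma icoeff_smult: "icoeff (smult r P) n = r * icoeff P n"
  by (simp add: icoeff_def)

lemma icoeff_pCons: "icoeff (pCons 0 P) n = icoeff P (n - 1)"
  by (auto simp: icoeff_def coeff_pCons nat_diff_distrib split: nat.splits)

lemma ucoeff_add: "ucoeff s m (P + Q) = ucoeff s m P + ucoeff s m Q"
proof -
  obtain K where K: "\<forall>R\<in>set [P, Q, P + Q]. int (degree R) < m + int K"
    using ucoeff_bound by blast
  then show ?thesis
    by (simp add: ucoeff_eq_sum[of _ m K] icoeff_add distrib_left sum.distrib)
qed

lemma ucoeff_smult: "ucoeff s m (smult r P) = r * ucoeff s m P"
proof -
  obtain K where K: "\<forall>R\<in>set [P, smult r P]. int (degree R) < m + int K"
    using ucoeff_bound by blast
  then show ?thesis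
    by (simp add: ucoeff_eq_sum[of _ m K] icoeff_smult sum_distrib_left ac_simps del: degree_smult_eq)
qed

lemma ucoeff_0: "ucoeff s m 0 = 0"
  using ucoeff_smult[of s m 0 0] by simp

lemma ucoeff_minus: "ucoeff s m (- P) = - ucoeff s m P"
  using ucoeff_smult[of s m "- 1" P] by simp

lemma ucoeff_pCons: "ucoeff s m (pCons 0 P) = ucoeff s (m - 1) P"
  unfolding ucoeff_def icoeff_pCons by (simp add: algebra_simps)

text \<open>Writing \<open>u - \<beta> = u (1 - \<beta>/u)\<close>, the factor \<open>u\<close>
  lowers \<open>m\<close> and the other factor lowers \<open>s\<close>; on the weights this is
  Pascal's rule.\<close>

lemma ucoeff_shift:
  "ucoeff s m (pCons 0 P - smult [:0, 1:] P) = ucoeff (s - 1) (m - 1) P"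
proof -
  let ?b = "[:0, 1:] :: int poly" and ?B = "\<lambda>s k. of_int (int_binomial (s + int k - 1) k) :: int poly"
  obtain K where "\<forall>R\<in>set [P]. int (degree R) < (m - 1) + int K"
    using ucoeff_bound by blast
  then have K: "int (degree P) < (m - 1) + int (Suc K)" "int (degree P) < m + int K"
    by simp_all
  have B: "?B s (Suc k) - ?B s k = ?B (s - 1) (Suc k)" for k
    using int_binomial_Suc[of "s + int k - 1" k] by (simp add: algebra_simps)
  have "ucoeff s m (pCons 0 P - smult ?b P) = ucoeff s (m - 1) P - ?b * ucoeff s m P"
    using ucoeff_add[of s m "pCons 0 P" "- smult ?b P"]
    by (simp add: ucoeff_minus ucoeff_smult ucoeff_pCons)
  also have "?b * ucoeff s m P = (\<Sum>k<K. ?B s k * ?b ^ Suc k * icoeff P (m + int k))"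
    unfolding ucoeff_eq_sum[OF K(2)] sum_distrib_left by (simp only: power_Suc ac_simps)
  also have "ucoeff s (m - 1) P = icoeff P (m - 1) + (\<Sum>k<K. ?B s (Suc k) * ?b ^ Suc k * icoeff P (m + int k))"
    unfolding ucoeff_eq_sum[OF K(1)] sum.lessThan_Suc_shift by (simp add: algebra_simps)
  finally have "ucoeff s m (pCons 0 P - smult ?b P)
      = icoeff P (m - 1) + (\<Sum>k<K. (?B s (Suc k) - ?B s k) * ?b ^ Suc k * icoeff P (m + int k))"
    by (simp only: left_diff_distrib sum_subtractf add_diff_eq)
  also have "\<dots> = ucoeff (s - 1) (m - 1) P"
    unfolding ucoeff_eq_sum[OF K(1)] sum.lessThan_Suc_shift B by (simp add: algebra_simps)
  finally show ?thesis .
qed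

lemma ucoeff_0_left: "ucoeff 0 m P = icoeff P m"
proof -
  have "(\<lambda>k. of_int (int_binomial (0 + int k - 1) k) * [:0, 1:] ^ k * icoeff P (m + int k))
      = (\<lambda>k. if k = 0 then icoeff P m else 0)"
    by (auto simp: fun_eq_iff int_binomial_pred)
  then have "ucoeff 0 m P = Sum_any (\<lambda>k::nat. if k = 0 then icoeff P m else 0)"
    unfolding ucoeff_def by (simp only:)
  also have "\<dots> = icoeff P m"
    by (subst Sum_any.expand_superset[of "{0}"]) auto
  finally show ?thesis .
qed

section \<open>The matrix entries and the operators acting on them\<close>

type_synonym xyu_series = "(var, int poly poly) mfps"

text \<open>Applied to \<open>c(i, j)\<close> this gives a matrix entry
  (\<open>entry_eq_msuminf\<close>). Being compatible with the variables and with \<beta>, it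
  carries identities between the generating series over to the entries.\<close>

definition entry :: "int \<Rightarrow> int \<Rightarrow> xyu_series \<Rightarrow> xy_series" where
  "entry s m F = Abs_mfps (\<lambda>e. ucoeff s m (mcoeff F e))"

lemma mcoeff_entry [simp]: "mcoeff (entry s m F) e = ucoeff s m (mcoeff F e)"
  by (simp add: entry_def)

abbreviation betu :: xyu_series where "betu \<equiv> mconst [:[:0, 1:]:]"
abbreviation uu :: xyu_series where "uu \<equiv> mconst [:0, 1:]"
abbreviation xu :: "nat \<Rightarrow> xyu_series" where "xu i \<equiv> mvar (XVar i)"
abbreviation yu :: "nat \<Rightarrow> xyu_series" where "yu i \<equiv> mvar (YVar i)"
abbreviation omu :: "nat \<Rightarrow> xyu_series" where "omu i \<equiv> 1 + betu * xu i"

lemma entry_add: "entry s m (F + G) = entry s m F + entry s m G"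
  by (rule mfps_eqI) (simp add: ucoeff_add)

lemma entry_minus: "entry s m (- F) = - entry s m F"
  by (rule mfps_eqI) (simp add: ucoeff_minus)

lemma entry_diff: "entry s m (F - G) = entry s m F - entry s m G"
  using entry_add[of s m F "- G"] by (simp add: entry_minus)

lemma entry_mvar: "entry s m (mvar v * F) = mvar v * entry s m F"
proof (rule mfps_eqI)
  fix e
  show "mcoeff (entry s m (mvar v * F)) e = mcoeff (mvar v * entry s m F) e"
    by (cases e v rule: exp_cases) (simp_all add: mcoeff_mvar_mult ucoeff_0)
qed

lemma entry_mconst: "entry s m (mconst [:r:] * F) = mconst r * entry s m F"
  by (rule mfps_eqI) (simp add: ucoeff_smult)

lemma entry_u: "entry s m (uu * F) = entry s (m - 1) F"
  by (rule mfps_eqI) (simp add: ucoeff_pCons)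

lemma entry_u_minus_bet: "entry s m (mconst ([:0, 1:] - [:[:0, 1:]:]) * F) = entry (s - 1) (m - 1) F"
  by (rule mfps_eqI) (simp only: mcoeff_entry mcoeff_mconst_mult left_diff_distrib ucoeff_shift[symmetric], simp)

lemma entry_omu: "entry s m (omu i * F) = om i * entry s m F"
  by (simp only: distrib_right mult_1 mult.assoc entry_add entry_mconst entry_mvar)

lemma entry_yu: "entry s m ((1 + betu * yu i) * F) = (1 + bet * yv i) * entry s m F"
  by (simp only: distrib_right mult_1 mult.assoc entry_add entry_mconst entry_mvar)

lemma entry_mswap: "entry s m (mswap \<sigma> F) = mswap \<sigma> (entry s m F)"
  by (rule mfps_eqI) simp

lemma entry_1: "1 \<le> m \<Longrightarrow> entry s m 1 = 0"
proof (rule mfps_eqI)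
  fix e assume "1 \<le> m"
  then have "ucoeff s m 1 = 0"
    by (subst ucoeff_eq_sum[of _ _ 0]) auto
  then show "mcoeff (entry s m 1) e = mcoeff 0 e"
    by (simp add: ucoeff_0)
qed

definition yiu :: "nat \<Rightarrow> xyu_series" where
  "yiu a = geo (YVar a) (- [:[:0, 1:]:])"

definition gu :: "nat \<Rightarrow> xyu_series" where
  "gu a = geo (XVar a) ([:0, 1:] - [:[:0, 1:]:])"

lemma yiu: "(1 + betu * yu a) * yiu a = 1"
  using geo_inverse[of "- [:[:0, 1:]:]" "YVar a"] by (simp only: yiu_def mconst_hom) simp

lemma gu: "(1 - mconst ([:0, 1:] - [:[:0, 1:]:]) * xu a) * gu a = 1"
  unfolding gu_def by (rule geo_inverse)

lemma gu': "(1 + betu * xu a - uu * xu a) * gu a = 1"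
  using gu[of a] by (simp only: mconst_hom left_diff_distrib) (simp add: algebra_simps)

definition yfac :: "nat \<Rightarrow> xyu_series" where
  "yfac a = (1 + betu * yu a - uu * yu a) * yiu a"

definition xfac :: "nat \<Rightarrow> xyu_series" where
  "xfac a = omu a * gu a"

definition c_gen :: "nat \<Rightarrow> nat \<Rightarrow> xyu_series" where
  "c_gen n r = (\<Prod>a\<in>{1..n}. yfac a) * (\<Prod>a\<in>{1..r}. xfac a)"

lemma c_series_eq: "c_series p q i j = c_gen (q i) (p j)"
  unfolding c_series_def c_gen_def Let_def yfac_def xfac_def
  by (simp only: mquot_unit[OF yiu] mquot_unit[OF gu'])

lemma entry_eq_msuminf:
  "msuminf (\<lambda>k. of_int (int_binomial (s + int k - 1) k) * bet ^ k * c_coeff p q (m + int k) i j)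
    = entry s m (c_gen (q i) (p j))"
proof (rule mfps_eqI)
  fix e
  have "of_int a * bet ^ k * F = mconst (of_int a * [:0, 1:] ^ k) * F" for a k and F :: xy_series
    by (simp add: mconst_hom mconst_power mconst_of_int)
  moreover have "mcoeff (c_coeff p q n i j) e = icoeff (mcoeff (c_gen (q i) (p j)) e) n" for n
    by (simp add: c_coeff_def icoeff_def c_series_eq)
  ultimately show "mcoeff (msuminf (\<lambda>k. of_int (int_binomial (s + int k - 1) k) * bet ^ k
      * c_coeff p q (m + int k) i j)) e = mcoeff (entry s m (c_gen (q i) (p j))) e"
    by (simp add: msuminf_def ucoeff_def)
qed

abbreviation swu :: "nat \<Rightarrow> xyu_series \<Rightarrow> xyu_series" where
  "swu i \<equiv> mswap (transpose (XVar i) (XVar (Suc i)))"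

text \<open>The operator adds the factor for \<open>x_{r+1}\<close> together with
  \<open>u - \<beta>\<close>; by \<open>ucoeff_shift\<close> the latter lowers both \<open>s\<close>
  and \<open>m\<close>.\<close>

lemma isobaric_entry:
  assumes "1 \<le> r"
  shows "isobaric r (entry s m (c_gen n r)) = entry (s - 1) (m - 1) (c_gen n (Suc r))"
proof (rule isobaric_eqI)
  let ?c = "[:0, 1:] - [:[:0, 1:]:] :: int poly poly"
  let ?x = "xu r" and ?z = "xu (Suc r)" and ?S = "swu r"
  obtain r' where r: "r = Suc r'"
    using assms by (cases r) auto
  define Y where "Y = (\<Prod>a\<in>{1..n}. yfac a) * (\<Prod>a\<in>{1..r'}. xfac a)"
  have C: "c_gen n r = Y * xfac r" "c_gen n (Suc r) = Y * xfac r * xfac (Suc r)"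
    unfolding c_gen_def Y_def r by (simp_all add: mult.assoc)
  have "?S (yfac a) = yfac a" for a
    by (simp add: yfac_def yiu_def mswap_hom mswap_geo)
  moreover have "?S (xfac a) = xfac a" if "a \<in> {1..r'}" for a
    using that r by (simp add: xfac_def gu_def mswap_hom mswap_geo)
  ultimately have SY: "?S Y = Y"
    by (simp add: Y_def mswap_hom(4) mswap_prod)
  have "?S (xfac r) = xfac (Suc r)"
    by (simp add: xfac_def gu_def mswap_hom mswap_geo)
  then have SC: "?S (c_gen n r) = Y * xfac (Suc r)"
    by (simp add: C mswap_hom(4) SY)
  have g: "gu r - gu (Suc r) = mconst ?c * (?x - ?z) * (gu r * gu (Suc r))"
  proof -
    have "gu r - gu (Suc r) = gu r * ((1 - mconst ?c * ?z) * gu (Suc r)) - gu (Suc r) * ((1 - mconst ?c * ?x) * gu r)"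
      unfolding gu by simp
    also have "\<dots> = mconst ?c * (?x - ?z) * (gu r * gu (Suc r))"
      by (simp only: algebra_simps)
    finally show ?thesis .
  qed
  have "omu (Suc r) * c_gen n r - omu r * ?S (c_gen n r) = Y * omu r * omu (Suc r) * (gu r - gu (Suc r))"
    unfolding SC unfolding C xfac_def by (simp add: algebra_simps)
  also have "\<dots> = ?x * (mconst ?c * c_gen n (Suc r)) - ?z * (mconst ?c * c_gen n (Suc r))"
    unfolding g C xfac_def by (simp only: algebra_simps)
  finally have "entry s m (omu (Suc r) * c_gen n r - omu r * ?S (c_gen n r))
      = entry s m (?x * (mconst ?c * c_gen n (Suc r)) - ?z * (mconst ?c * c_gen n (Suc r)))"
    by simp
  then show "entry (s - 1) (m - 1) (c_gen n (Suc r)) * (xv r - xv (Suc r))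
      = om (Suc r) * entry s m (c_gen n r) - om r * sw r (entry s m (c_gen n r))"
    unfolding entry_diff entry_omu entry_mvar entry_mswap entry_u_minus_bet
    by (simp only: left_diff_distrib right_diff_distrib mult.commute)
qed

text \<open>This is \<open>(1 + \<beta>x_1)\<close> to the integer power \<open>s\<close>, as
  \<open>om_pow_eq\<close> confirms.\<close>

definition om_pow :: "int \<Rightarrow> xy_series" where
  "om_pow s = entry s 0 (xfac (Suc 0))"

text \<open>\<open>xfac\<close> is the geometric series \<open>1 / (1 - u xi)\<close>, so it
  satisfies \<open>xfac = 1 + u xi xfac\<close>.\<close>

lemma entry_xfac_step: "entry s m (xfac (Suc 0)) = entry s m 1 + xi (Suc 0) * entry s (m - 1) (xfac (Suc 0))"
proof -
  let ?x = "xu (Suc 0)"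
  have "xfac (Suc 0) = 1 + uu * (?x * gu (Suc 0))"
    using gu'[of "Suc 0"] unfolding xfac_def by (simp add: algebra_simps)
  then have "entry s m (xfac (Suc 0)) = entry s m 1 + xv (Suc 0) * entry s (m - 1) (gu (Suc 0))"
    by (simp add: entry_add entry_u entry_mvar)
  moreover have "entry s (m - 1) (gu (Suc 0)) = oinv (Suc 0) * entry s (m - 1) (xfac (Suc 0))"
    unfolding xfac_def entry_omu by (simp only: oinv_om_cancel)
  ultimately show ?thesis
    by (simp add: xi_def mult.assoc)
qed

lemma entry_xfac: "entry s (int m) (xfac (Suc 0)) = xi (Suc 0) ^ m * om_pow s"
proof (induction m)
  case (Suc m)
  then show ?case
    using entry_xfac_step[of s "int (Suc m)"] by (simp add: entry_1 mult.assoc)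
qed (simp add: om_pow_def)

text \<open>The shift by \<open>u - \<beta>\<close> multiplies by \<open>1 - \<beta> xi\<close>,
  which is \<open>oinv\<close>.\<close>

lemma om_pow_pred: "om_pow (s - 1) = oinv (Suc 0) * om_pow s"
proof -
  let ?X = "xfac (Suc 0)"
  have "om_pow (s - 1) = entry s 1 (mconst ([:0, 1:] - [:[:0, 1:]:]) * ?X)"
    unfolding om_pow_def entry_u_minus_bet by simp
  also have "\<dots> = entry s 0 ?X - bet * entry s 1 ?X"
    unfolding mconst_hom left_diff_distrib entry_diff entry_u entry_mconst by simp
  also have "\<dots> = om_pow s - bet * (xi (Suc 0) * om_pow s)"
    using entry_xfac[of s 1] by (simp add: om_pow_def)
  also have "\<dots> = oinv (Suc 0) * om_pow s"
    unfolding oinv_eq by (simp add: algebra_simps)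
  finally show ?thesis .
qed

lemma om_pow_0: "om_pow 0 = 1"
proof -
  have "entry 0 (- 1) F = 0" for F
    by (rule mfps_eqI) (simp add: ucoeff_0_left icoeff_def)
  moreover have "entry 0 0 1 = 1"
    by (rule mfps_eqI) (simp add: ucoeff_0_left icoeff_def)
  ultimately show ?thesis
    using entry_xfac_step[of 0 0] by (simp add: om_pow_def)
qed

lemma om_pow_diff_nat: "om_pow (s - int b) = oinv (Suc 0) ^ b * om_pow s"
proof (induction b)
  case (Suc b)
  have "om_pow (s - int (Suc b)) = om_pow ((s - int b) - 1)"
    by (simp add: algebra_simps)
  then show ?case
    using Suc by (simp only: om_pow_pred power_Suc mult.assoc)
qed simp

lemma om_pow_eq: "om_pow (int a - int b) = om (Suc 0) ^ a * oinv (Suc 0) ^ b"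
proof -
  have "oinv (Suc 0) ^ a * om_pow (int a) = 1"
    using om_pow_diff_nat[of "int a" a] om_pow_0 by simp
  then have "om (Suc 0) ^ a * (oinv (Suc 0) ^ a * om_pow (int a)) = om (Suc 0) ^ a"
    by simp
  then have "om_pow (int a) = om (Suc 0) ^ a"
    by (simp only: mult.assoc[symmetric] power_mult_distrib[symmetric] om_oinv power_one mult_1)
  then show ?thesis
    unfolding om_pow_diff_nat by (simp only: mult.commute)
qed

text \<open>Each \<open>y\<close> factor is \<open>1 - u y / (1 + \<beta>y)\<close> and contributes
  \<open>xi - y / (1 + \<beta>y)\<close>. The surplus \<open>d\<close> is general because the term 1
  keeps the index while \<open>n\<close> drops.\<close>

lemma entry_c_gen_1:
  "entry s (int (n + d)) (c_gen n 1)
    = xi (Suc 0) ^ d * (\<Prod>a\<in>{1..n}. - (yv a * yinv a) + 1 * xi (Suc 0)) * om_pow s"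
proof (induction n arbitrary: d)
  case 0
  then show ?case by (simp add: c_gen_def entry_xfac)
next
  case (Suc n)
  let ?C = "c_gen n 1" and ?P = "\<Prod>a\<in>{1..n}. - (yv a * yinv a) + 1 * xi (Suc 0)"
  have "c_gen (Suc n) 1 = ?C * yfac (Suc n)"
    unfolding c_gen_def by (simp add: ac_simps)
  also have "\<dots> = ?C * ((1 + betu * yu (Suc n)) * yiu (Suc n)) - uu * (yu (Suc n) * (yiu (Suc n) * ?C))"
    unfolding yfac_def by (simp only: algebra_simps)
  finally have C: "c_gen (Suc n) 1 = ?C - uu * (yu (Suc n) * (yiu (Suc n) * ?C))"
    unfolding yiu by simp
  have inv: "entry s m (yiu (Suc n) * F) = yinv (Suc n) * entry s m F" for m F
  proof -
    have "entry s m F = entry s m ((1 + betu * yu (Suc n)) * (yiu (Suc n) * F))"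
      unfolding mult.assoc[symmetric] yiu by simp
    then have "yinv (Suc n) * entry s m F
        = (1 + bet * yv (Suc n)) * yinv (Suc n) * entry s m (yiu (Suc n) * F)"
      unfolding entry_yu by (simp only: ac_simps)
    then show ?thesis
      unfolding yinv by simp
  qed
  have "entry s (int (Suc n + d)) (c_gen (Suc n) 1)
      = entry s (int (n + Suc d)) ?C - yv (Suc n) * (yinv (Suc n) * entry s (int (n + d)) ?C)"
    unfolding C entry_diff entry_u entry_mvar inv by simp
  also have "\<dots> = xi (Suc 0) ^ d * (?P * (- (yv (Suc n) * yinv (Suc n)) + 1 * xi (Suc 0))) * om_pow s"
    unfolding Suc.IH power_Suc by (simp add: algebra_simps)
  also have "?P * (- (yv (Suc n) * yinv (Suc n)) + 1 * xi (Suc 0))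
      = (\<Prod>a\<in>{1..Suc n}. - (yv a * yinv a) + 1 * xi (Suc 0))"
    by (simp add: mult.commute)
  finally show ?case .
qed

lemma entry_base: "entry s (int n) (c_gen n 1) = om_pow (s - int n) * lin_prod n (Suc 0)"
proof -
  have "lin_prod n (Suc 0) = om (Suc 0) ^ n * (\<Prod>a\<in>{1..n}. - (yv a * yinv a) + 1 * xi (Suc 0))"
    unfolding lin_prod_def lin_eq_xi prod.distrib by simp
  then have "om_pow (s - int n) * lin_prod n (Suc 0)
      = (om (Suc 0) * oinv (Suc 0)) ^ n * (\<Prod>a\<in>{1..n}. - (yv a * yinv a) + 1 * xi (Suc 0)) * om_pow s"
    unfolding om_pow_diff_nat power_mult_distrib by (simp only: ac_simps)
  then show ?thesis
    using entry_c_gen_1[of s n 0] unfolding om_oinv by simp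
qed

text \<open>Iterates \<open>isobaric_entry\<close> from \<open>entry_base\<close>; the sum
  \<open>s + r\<close> is constant along the chain and so fixes the power of
  \<open>om\<close>.\<close>

lemma entry_eq_iso_chain:
  "entry s (int n - int r) (c_gen n (Suc r)) = iso_chain r (om_pow (s + int r - int n) * lin_prod n (Suc 0))"
proof (induction r arbitrary: s)
  case 0
  then show ?case
    using entry_base[of s n] by simp
next
  case (Suc r)
  have "entry s (int n - int (Suc r)) (c_gen n (Suc (Suc r)))
      = isobaric (Suc r) (entry (s + 1) (int n - int r) (c_gen n (Suc r)))"
    by (subst isobaric_entry) (simp_all add: algebra_simps)
  then show ?case
    unfolding Suc.IH by (simp add: algebra_simps)
qed

lemma skew_Delta_eq_chain_det:
  assumes "\<And>j. j \<in> {1..t} \<Longrightarrow> 0 < p j"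
  shows "skew_Delta t (skew_outer t q) (skew_inner t p) (c_coeff p q)
    = chain_det t (\<lambda>i. lin_prod (q (Suc i)) (Suc 0)) (\<lambda>j. p (Suc j) - 1)"
  unfolding skew_Delta_def chain_det_def
proof (intro arg_cong[of _ _ det] cong_mat refl)
  fix i j assume ij: "i < t" "j < t"
  let ?i = "Suc i" and ?j = "Suc j"
  define s where "s = skew_outer t q ?i - skew_inner t p ?j"
  obtain r where r: "p ?j = Suc r"
    using assms[of ?j] ij by (cases "p ?j") auto
  \<comment> \<open>\<open>t\<close>, \<open>q\<close> and \<open>p\<close> cancel from the power of
    \<open>1 + \<beta>x_1\<close>, leaving \<open>i - j\<close>, while \<open>i\<close> and
    \<open>j\<close> cancel from the index of the coefficient; here
    \<open>r = p - 1\<close>.\<close>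
  have s: "s + int r - int (q ?i) = int i - int j" "s + int ?j - int ?i = int (q ?i) - int r"
    by (simp_all add: s_def skew_outer_def skew_inner_def r)
  have "msuminf (\<lambda>k. of_int (int_binomial (s + int k - 1) k) * bet ^ k
      * c_coeff p q (s + int ?j - int ?i + int k) ?i ?j)
    = iso_chain r (om (Suc 0) ^ i * oinv (Suc 0) ^ j * lin_prod (q ?i) (Suc 0))"
    unfolding entry_eq_msuminf s(2) r entry_eq_iso_chain s(1) om_pow_eq ..
  then show "(case (i, j) of (i', j') \<Rightarrow> let i = i' + 1; j = j' + 1 in
      msuminf (\<lambda>k. of_int (int_binomial (skew_outer t q i - skew_inner t p j + int k - 1) k) * bet ^ k
        * c_coeff p q (skew_outer t q i - skew_inner t p j + int j - int i + int k) i j))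
    = (case (i, j) of (i, j) \<Rightarrow> iso_chain (p (Suc j) - 1) (om (Suc 0) ^ i * oinv (Suc 0) ^ j * lin_prod (q (Suc i)) (Suc 0)))"
    by (simp add: s_def r)
qed

theorem corollary6p4:
  fixes w p q :: "nat \<Rightarrow> nat" and n t :: nat
  assumes "w permutes {1..n}"
    and "avoids_321 w"
    and "strict_antimono_on {1..t} p" and "\<forall>i\<in>{1..t}. p i > 0"
    and "strict_antimono_on {1..t} q" and "\<forall>i\<in>{1..t}. q i > 0"
    and "associated t p q w"
    and "\<forall>i\<in>{1..t}. int (q i) \<ge> int (p i) - 1"
  shows "double_grothendieck w
    = skew_Delta t (skew_outer t q) (skew_inner t p) (c_coeff p q)"
proof -
  \<comment> \<open>Large enough to contain \<open>{1..n}\<close> and to bound \<open>t\<close> and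
    every \<open>p i\<close>.\<close>
  define N where "N = n + t + (\<Sum>i\<in>{1..t}. p i)"
  have "is_double_grothendieck w (chain_det t (\<lambda>i. lin_prod (q (Suc i)) (Suc 0)) (\<lambda>j. p (Suc j) - 1))"
  proof (rule reach_imp_grothendieck[OF reach_associated])
    show "w permutes {1..N}"
      using assms(1) by (rule permutes_subset) (simp add: N_def)
    show "q j < q i" "p j < p i" if "1 \<le> i" "i < j" "j \<le> t" for i j
      using assms(3,5) that by (auto simp: monotone_on_def)
    show "p i \<le> N" if "i \<in> {1..t}" for i
      using member_le_sum[of i "{1..t}" p] that by (simp add: N_def)
    show "p i \<le> q i + 1" if "i \<in> {1..t}" for i
      using assms(8) that by force
  qed (use assms in \<open>auto simp: N_def\<close>)
  then show ?thesis
    using assms(4) by (subst skew_Delta_eq_chain_det) (auto intro: double_grothendieck_eqI)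
qed

end
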